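(* Let $d \geq 2$ be an integer and let $\mu$ be any probability measure on $[0,\infty)$ with $\mu(\{0\})<1$. For the spherical Poisson Boolean model in $\mathbb{R}^d$ with radius distribution $\mu$, the vacancy critical value $\lambda_c^*$ and the expected-diameter critical value $\lambda_D$ satisfy $$\lambda_c^* \geq \lambda_D .$$
   Context: For $\lambda \in (0,\infty)$, let $\mathcal{P}_\lambda = \{y_k : k \in \mathbb{N}\}$ be a homogeneous Poisson point process in $\mathbb{R}^d$ of intensity $\lambda$ (viewed as a random subset of $\mathbb{R}^d$, enumerated in order of increasing distance from the origin), and let $\rho_1,\rho_2,\ldots$ be independent random variables with common distribution $\mu$, independent of $\mathcal{P}_\lambda$. For $x\in\mathbb{R}^d$, $r \ge 0$ let $B(x,r) = \{y\in\mathbb{R}^d : \|y-x\|\le r\}$ (Euclidean norm). The occupied and vacant regions of the spherical Poisson Boolean model are $$Z_\lambda = \bigcup_{k} B(y_k,\rho_k), \qquad Z_\lambda^* = \mathbb{R}^d\setminus Z_\lambda .$$ A set percolates if it has an unbounded connected component. Let $U_\lambda^*$ be the event that $Z_\lambda^*$ percolates. One has $\mathbb{P}[U^*_\lambda]\in\{0,1\}$ by ergodicity, and $\mathbb{P}[U^*_\lambda]$ is decreasing in $\lambda$. Define $\lambda_c^* := \inf\{\lambda>0 : \mathbb{P}[U_\lambda^*]=0\}$. For non-empty $B\subset\mathbb{R}^d$ let $D(B) := \sup_{x,y\in B}\|x-y\|$ be its Euclidean diameter, and set $D(\emptyset)=0$. Let $W_\lambda$ be the connected component of $Z_\lambda$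 containing the origin (empty if the origin is not in $Z_\lambda$), and set $\lambda_D := \inf\{\lambda>0 : \mathbb{E}[D(W_\lambda)]=\infty\}$. *)

theory Defs
  imports "HOL-Probability.Probability"
begin

text \<open>
  A random subset \<open>P\<close> of Euclidean space is a homogeneous Poisson point process of intensity
  \<open>lam\<close> if it is almost surely locally finite, the number of its points in a bounded Borel set
  \<open>A\<close> is Poisson distributed with mean \<open>lam\<close> times the volume of \<open>A\<close>, and the numbers of points in disjoint sets
  are independent. The Poisson weights are written out because \<open>poisson_pmf\<close> is only specified
  for positive rates, whereas \<open>A\<close> may be a null set. Local finiteness is stated separately
  because \<open>card\<close> is \<open>0\<close> on infinite sets.
\<close>

locale poisson_point_process = prob_space M for M :: "'w measure" +
  fixes P :: "'w \<Rightarrow> 'a::euclidean_space set" and lam :: real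
  assumes intensity_pos: "0 < lam"
    and locally_finite: "AE \<omega> in M. \<forall>A. bounded A \<longrightarrow> finite (P \<omega> \<inter> A)"
    and count_measurable:
      "\<And>A. \<lbrakk>A \<in> sets borel; bounded A\<rbrakk> \<Longrightarrow>
        random_variable (count_space UNIV) (\<lambda>\<omega>. card (P \<omega> \<inter> A))"
    and count_poisson:
      "\<And>A k. \<lbrakk>A \<in> sets borel; bounded A\<rbrakk> \<Longrightarrow>
        prob {\<omega> \<in> space M. card (P \<omega> \<inter> A) = k} =
          (lam * measure lborel A) ^ k / fact k * exp (- (lam * measure lborel A))"
    and count_indep:
      "\<And>(A :: nat \<Rightarrow> 'a set) I. \<lbrakk>finite I; disjoint_family_on A I;
          \<And>i. i \<in> I \<Longrightarrow> A i \<in> sets borel; \<And>i. i \<in> I \<Longrightarrow> bounded (A i)\<rbrakk> \<Longrightarrow>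
        indep_vars (\<lambda>_. count_space UNIV) (\<lambda>i \<omega>. card (P \<omega> \<inter> A i)) I"

text \<open>
  The points \<open>y k\<close> of the process carry independent radii \<open>\<rho> k\<close> with law \<open>\<mu>\<close>. As the points are
  enumerated by distance from the origin, the sequence \<open>y\<close> is almost surely a function of the
  point process, so independence of the radii from the process is independence from \<open>y\<close>. It is
  stated through the generated sigma-algebras because \<open>indep_var\<close> requires both variables to take
  values in the same type.
\<close>

locale poisson_boolean_model =
  poisson_point_process M "\<lambda>\<omega>. range (\<lambda>k. y k \<omega>)" lam
  for M :: "'w measure" and y :: "nat \<Rightarrow> 'w \<Rightarrow> 'a::euclidean_space" and lam :: real +
  fixes \<rho> :: "nat \<Rightarrow> 'w \<Rightarrow> real" and \<mu> :: "real measure"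
  assumes points_measurable: "\<And>k. random_variable borel (y k)"
    and points_distinct: "AE \<omega> in M. inj (\<lambda>k. y k \<omega>)"
    and points_ordered: "AE \<omega> in M. incseq (\<lambda>k. norm (y k \<omega>))"
    and radii_indep: "indep_vars (\<lambda>_. borel) \<rho> UNIV"
    and radii_law: "\<And>k. distr M borel (\<rho> k) = \<mu>"
    and radii_indep_points:
      "indep_set (sets (vimage_algebra (space M) (\<lambda>\<omega> k. y k \<omega>) (\<Pi>\<^sub>M k\<in>UNIV. borel)))
         (sets (vimage_algebra (space M) (\<lambda>\<omega> k. \<rho> k \<omega>) (\<Pi>\<^sub>M k\<in>UNIV. borel)))"

definition occupied ::
    "(nat \<Rightarrow> 'w \<Rightarrow> 'a::euclidean_space) \<Rightarrow> (nat \<Rightarrow> 'w \<Rightarrow> real) \<Rightarrow> 'w \<Rightarrow> 'a set" where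
  "occupied y \<rho> \<omega> = (\<Union>k. cball (y k \<omega>) (\<rho> k \<omega>))"

definition vacant ::
    "(nat \<Rightarrow> 'w \<Rightarrow> 'a::euclidean_space) \<Rightarrow> (nat \<Rightarrow> 'w \<Rightarrow> real) \<Rightarrow> 'w \<Rightarrow> 'a set" where
  "vacant y \<rho> \<omega> = - occupied y \<rho> \<omega>"

definition percolates :: "'a::euclidean_space set \<Rightarrow> bool" where
  "percolates S \<longleftrightarrow> (\<exists>C\<in>components S. \<not> bounded C)"

text \<open>
  The library's \<open>diameter\<close> is real-valued and unspecified on unbounded sets. Here the value is
  \<open>\<infinity>\<close> on unbounded sets, and \<open>0\<close> on the empty set, since \<open>0\<close> is the supremum of the empty set
  in \<open>ennreal\<close>.
\<close>

definition ediameter :: "'a::euclidean_space set \<Rightarrow> ennreal" where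
  "ediameter B = (SUP x\<in>B. SUP y\<in>B. ennreal (norm (x - y)))"

definition origin_cluster ::
    "(nat \<Rightarrow> 'w \<Rightarrow> 'a::euclidean_space) \<Rightarrow> (nat \<Rightarrow> 'w \<Rightarrow> real) \<Rightarrow> 'w \<Rightarrow> 'a set" where
  "origin_cluster y \<rho> \<omega> = connected_component_set (occupied y \<rho> \<omega>) 0"

text \<open>
  The critical values depend on a family of models, one for each intensity. Both are infima in
  \<open>[0, \<infinity>]\<close>, equal to \<open>\<infinity>\<close> if no intensity qualifies. The event that the vacant region percolates
  is measurable only up to a null set in general (on the null set where infinitely many balls
  meet a bounded set), hence the completion; membership in \<open>null_sets\<close> includes measurability,
  which an equation \<open>measure _ _ = 0\<close> would not.
\<close>

definition lambda_c_star ::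
    "(real \<Rightarrow> 'w measure) \<Rightarrow> (real \<Rightarrow> nat \<Rightarrow> 'w \<Rightarrow> 'a::euclidean_space) \<Rightarrow>
      (real \<Rightarrow> nat \<Rightarrow> 'w \<Rightarrow> real) \<Rightarrow> ennreal" where
  "lambda_c_star M y \<rho> =
    (INF lam\<in>{lam. 0 < lam \<and>
        {\<omega> \<in> space (M lam). percolates (vacant (y lam) (\<rho> lam) \<omega>)} \<in> null_sets (completion (M lam))}.
      ennreal lam)"

definition lambda_D ::
    "(real \<Rightarrow> 'w measure) \<Rightarrow> (real \<Rightarrow> nat \<Rightarrow> 'w \<Rightarrow> 'a::euclidean_space) \<Rightarrow>
      (real \<Rightarrow> nat \<Rightarrow> 'w \<Rightarrow> real) \<Rightarrow> ennreal" where
  "lambda_D M y \<rho> =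
    (INF lam\<in>{lam. 0 < lam \<and>
        (\<integral>\<^sup>+\<omega>. ediameter (origin_cluster (y lam) (\<rho> lam) \<omega>) \<partial>M lam) = \<infinity>}.
      ennreal lam)"

end

theory Submission
  imports Defs
begin

text \<open>
  The reason for the inequality is this. Suppose the cluster of the origin has finite mean diameter,
  and fix \<open>\<delta> > 0\<close> such that radii of at least \<open>2 * \<delta>\<close> have positive probability. The mean diameter
  controls the sum over \<open>j\<close> of the probabilities that a chain of balls leads from the origin to
  distance \<open>j * \<delta>\<close> (\<open>summable_reach_prob\<close>). The same sum converges for chains
  that start at any ball meeting \<open>cball x \<delta>\<close>, for any centre \<open>x\<close>: the model is translation
  invariant (\<open>reach_prob_translate\<close>), and with positive probability, independently of all the other
  balls, some ball centred in \<open>cball 0 \<delta>\<close> covers \<open>cball 0 \<delta>\<close> and so joins to the origin every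
  chain that starts there (\<open>reach_prob_sprinkle\<close>). By the Borel-Cantelli lemma, almost surely every
  bounded set meets finitely many balls, every cluster is bounded, and far out on a ray a cluster
  that meets the ray at distance about \<open>t\<close> from the origin reaches less far than \<open>t\<close>.

  From there the argument is deterministic (\<open>vacant_percolates\<close>). A cluster that surrounds a large
  ball about the origin would have to cross the ray, but those that cross it are too small to
  surround the origin; so no cluster surrounds a large ball. As a closed set that separates two
  points has a component that separates them, vacant points just outside the clusters of larger and
  larger balls all lie in one component of the vacant region. Thus vacancy percolates almost
  surely whenever the mean diameter is finite (\<open>AE_vacant_percolates\<close>), and an intensity at which
  it almost surely does not percolate is one at which the mean diameter is infinite.

  The probabilistic facts are obtained from avoidance probabilities alone. A realisation is a set
  of pairs (centre, radius); the sets \<open>avoid B\<close> of configurations without a point in \<open>B\<close> are closed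
  under intersection, so the probabilities of the events \<open>avoid B\<close> determine the law of the random
  configuration (\<open>configurations_measure_eqI\<close>). They equal \<open>exp (- intensity B)\<close>
  (\<open>prob_config_avoid\<close>), where \<open>intensity\<close> is translation invariant and additive, and this
  gives invariance and independence of the configuration.
\<close>

section \<open>Chains of balls\<close>

definition touch :: "'a::metric_space \<times> real \<Rightarrow> 'a \<times> real \<Rightarrow> bool" where
  "touch z w \<longleftrightarrow> dist (fst z) (fst w) \<le> snd z + snd w"

text \<open>
  The ball \<open>(x, \<delta>)\<close> at which a chain starts need not belong to \<open>X\<close>; with \<open>\<delta> = 0\<close> a chain starts
  at a ball that contains \<open>x\<close>.
\<close>

definition reach :: "('a::metric_space \<times> real) set \<Rightarrow> 'a \<Rightarrow> real \<Rightarrow> real \<Rightarrow> bool" where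
  "reach X x \<delta> L \<longleftrightarrow>
    (\<exists>ws. set ws \<subseteq> X \<and> successively touch ((x, \<delta>) # ws) \<and>
      L \<le> dist x (fst (last ((x, \<delta>) # ws))) + snd (last ((x, \<delta>) # ws)))"

abbreviation ball_of :: "'a::metric_space \<times> real \<Rightarrow> 'a set" where
  "ball_of z \<equiv> cball (fst z) (snd z)"

definition cover :: "('a::metric_space \<times> real) set \<Rightarrow> 'a set" where
  "cover X = (\<Union>z\<in>X. ball_of z)"

definition locally_finite_set :: "('a::real_normed_vector \<times> real) set \<Rightarrow> bool" where
  "locally_finite_set X \<longleftrightarrow> (\<forall>R. finite {z\<in>X. norm (fst z) \<le> R})"

lemma touch_iff_meet:
  fixes z w :: "'a::euclidean_space \<times> real"
  assumes "0 \<le> snd z" "0 \<le> snd w"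
  shows "touch z w \<longleftrightarrow> ball_of z \<inter> ball_of w \<noteq> {}"
proof
  assume t: "touch z w"
  show "ball_of z \<inter> ball_of w \<noteq> {}"
  proof (cases "dist (fst z) (fst w) \<le> snd z")
    case True
    then have "fst w \<in> ball_of z \<inter> ball_of w" using assms by auto
    then show ?thesis by blast
  next
    case False
    define d where "d = dist (fst z) (fst w)"
    define p where "p = fst z + (snd z / d) *\<^sub>R (fst w - fst z)"
    have d: "d > snd z" "d \<le> snd z + snd w" "0 < d"
      using False t assms by (auto simp: d_def touch_def)
    have nd: "norm (fst w - fst z) = d" by (simp add: d_def dist_norm norm_minus_commute)
    have 1: "dist (fst z) p = snd z"
      using d assms nd by (simp add: p_def dist_norm)
    have "fst w - p = (1 - snd z / d) *\<^sub>R (fst w - fst z)" by (simp add: p_def algebra_simps)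
    then have "norm (fst w - p) = \<bar>1 - snd z / d\<bar> * d" by (simp add: nd)
    also have "\<dots> = d - snd z" using d assms by (simp add: abs_if field_simps)
    finally have "dist (fst w) p \<le> snd w" using d by (simp add: dist_norm)
    with 1 have "p \<in> ball_of z \<inter> ball_of w" by simp
    then show ?thesis by blast
  qed
next
  assume "ball_of z \<inter> ball_of w \<noteq> {}"
  then obtain p where "dist (fst z) p \<le> snd z" "dist (fst w) p \<le> snd w" by auto
  then show "touch z w" unfolding touch_def
    using dist_triangle2[of "fst z" "fst w" p] by linarith
qed

lemma reach_mono: "reach X x \<delta> L \<Longrightarrow> X \<subseteq> Y \<Longrightarrow> reach Y x \<delta> L"
  unfolding reach_def by blast

lemma locally_finite_set_subset: "locally_finite_set X \<Longrightarrow> Y \<subseteq> X \<Longrightarrow> locally_finite_set Y"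
  unfolding locally_finite_set_def by (auto intro: finite_subset[rotated])

lemma connected_chain:
  fixes ws :: "('a::euclidean_space \<times> real) list"
  assumes "successively touch ws" "\<And>z. z \<in> set ws \<Longrightarrow> 0 \<le> snd z"
  shows "connected (cover (set ws))"
  using assms
proof (induction ws rule: induct_list012)
  case (3 z w ws)
  have "ball_of z \<inter> ball_of w \<noteq> {}"
    using 3 touch_iff_meet[of z w] by simp
  moreover have "connected (cover (set (w # ws)))" using 3 by simp
  moreover have "cover (set (z # w # ws)) = ball_of z \<union> cover (set (w # ws))"
    by (auto simp: cover_def)
  moreover have "ball_of w \<subseteq> cover (set (w # ws))" by (auto simp: cover_def)
  ultimately show ?case
    by (metis Int_mono connected_Un convex_cball convex_connected order_refl subset_empty)
qed (auto simp: cover_def)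

lemma reach_imp_ediameter:
  fixes X :: "('a::euclidean_space \<times> real) set"
  assumes X: "\<And>z. z \<in> X \<Longrightarrow> 0 \<le> snd z" and r: "reach X 0 0 L" and L: "0 < L"
  shows "ennreal L \<le> ediameter (connected_component_set (cover X) 0)"
proof -
  obtain ws where ws: "set ws \<subseteq> X" "successively touch ((0, 0) # ws)"
    and end_ge: "L \<le> norm (fst (last ((0, 0) # ws))) + snd (last ((0, 0) # ws))"
    using r by (auto simp: reach_def)
  have ne: "ws \<noteq> []" using end_ge L by auto
  define z where "z = last ws"
  have z: "z \<in> set ws" "L \<le> norm (fst z) + snd z" using ne end_ge by (auto simp: z_def)
  have hd0: "0 \<in> ball_of (hd ws)"
    using ws(2) ne by (cases ws) (auto simp: touch_def)
  have "connected (cover (set ws))"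
    using ws X by (intro connected_chain) (auto simp: successively_Cons)
  moreover have "0 \<in> cover (set ws)" using hd0 ne unfolding cover_def
    by (intro UN_I[of "hd ws"]) auto
  moreover have "cover (set ws) \<subseteq> cover X" using ws by (auto simp: cover_def)
  ultimately have sub: "cover (set ws) \<subseteq> connected_component_set (cover X) 0"
    by (intro connected_component_maximal)
  obtain u :: 'a where u: "norm u = 1" "norm (fst z) *\<^sub>R u = fst z"
  proof (cases "fst z = 0")
    case True
    obtain b :: 'a where "b \<in> Basis" using nonempty_Basis by blast
    then show ?thesis using True that[of b] by auto
  next
    case False
    then show ?thesis using that[of "fst z /\<^sub>R norm (fst z)"] by auto
  qed
  have zr: "0 \<le> snd z" using z ws X by blast
  define p where "p = fst z + snd z *\<^sub>R u"
  have "p = (norm (fst z) + snd z) *\<^sub>R u" using u by (simp add: p_def scaleR_add_left)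
  then have np: "norm p = norm (fst z) + snd z" using u zr by simp
  have "p \<in> ball_of z" using u zr by (simp add: p_def dist_norm)
  then have "p \<in> connected_component_set (cover X) 0" using sub z unfolding cover_def by blast
  moreover have "0 \<in> connected_component_set (cover X) 0"
    using sub \<open>0 \<in> cover (set ws)\<close> by auto
  ultimately have "ennreal (norm (p - 0)) \<le> ediameter (connected_component_set (cover X) 0)"
    unfolding ediameter_def by (meson SUP_upper2 order_refl)
  moreover have "ennreal L \<le> ennreal (norm (p - 0))" using np z by (simp add: ennreal_leI)
  ultimately show ?thesis by (rule order_trans[rotated])
qed

section \<open>Percolation of the complement of a union of balls\<close>

text \<open>
  Bounded reach is required only at the points of \<open>D\<close>, so that for a countable \<open>D\<close> it can be
  verified almost surely. It implies that bounded sets meet finitely many balls, because a ball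
  that meets \<open>cball q \<delta>\<close> and has a distant centre is itself a chain that reaches far from \<open>q\<close>.
\<close>

locale ball_configuration =
  fixes X :: "('a::euclidean_space \<times> real) set" and \<delta> :: real and D :: "'a set"
  assumes radius_nonneg: "z \<in> X \<Longrightarrow> 0 \<le> snd z"
    and locally_finite: "locally_finite_set X"
    and delta_pos: "0 < \<delta>"
    and D_dense: "\<And>x. \<exists>q\<in>D. dist q x < \<delta>"
    and D_bounded_reach: "q \<in> D \<Longrightarrow> \<exists>L. \<not> reach X q \<delta> L"
begin

lemma reach_bound:
  assumes "\<not> reach X q \<delta> L" "z \<in> X" "set ws \<subseteq> X" "successively touch ((q, \<delta>) # ws @ [z])"
  shows "ball_of z \<subseteq> ball q L"
proof
  fix p assume p: "p \<in> ball_of z"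
  have "dist q (fst z) + snd z < L"
    using assms unfolding reach_def by (auto dest!: spec[of _ "ws @ [z]"])
  then show "p \<in> ball q L" using p dist_triangle[of q p "fst z"] by auto
qed

lemma finite_balls_meeting:
  assumes "bounded A"
  shows "finite {z\<in>X. ball_of z \<inter> A \<noteq> {}}"
proof -
  have "compact (closure A)" using assms by (simp add: compact_closure)
  moreover have "closure A \<subseteq> (\<Union>q\<in>D. ball q \<delta>)" using D_dense by fastforce
  ultimately obtain F where F: "F \<subseteq> D" "finite F" "closure A \<subseteq> (\<Union>q\<in>F. ball q \<delta>)"
    by (elim compactE_image) auto
  have one: "finite {z\<in>X. ball_of z \<inter> ball q \<delta> \<noteq> {}}" if q: "q \<in> F" for q
  proof -
    obtain L where L: "\<not> reach X q \<delta> L" using D_bounded_reach q F by blast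
    have "{z\<in>X. ball_of z \<inter> ball q \<delta> \<noteq> {}} \<subseteq> {z\<in>X. norm (fst z) \<le> norm q + L}"
    proof clarify
      fix c r assume z: "(c, r) \<in> X" and m: "ball_of (c, r) \<inter> ball q \<delta> \<noteq> {}"
      have r: "0 \<le> r" using radius_nonneg[OF z] by simp
      have "ball_of (q, \<delta>) \<inter> ball_of (c, r) \<noteq> {}" using m ball_subset_cball[of q \<delta>] by (simp add: disjoint_iff) (meson less_imp_le)
      then have "touch (q, \<delta>) (c, r)" using delta_pos r by (subst touch_iff_meet) auto
      then have "ball_of (c, r) \<subseteq> ball q L" using reach_bound[OF L z, of "[]"] by simp
      then have "c \<in> ball q L" using r centre_in_cball[of c r] by (simp only: fst_conv snd_conv) blast
      then show "norm (fst (c, r)) \<le> norm q + L"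
        using norm_triangle_ineq2[of c q] by (simp add: dist_norm norm_minus_commute)
    qed
    then show ?thesis using locally_finite finite_subset unfolding locally_finite_set_def by blast
  qed
  have "{z\<in>X. ball_of z \<inter> A \<noteq> {}} \<subseteq> (\<Union>q\<in>F. {z\<in>X. ball_of z \<inter> ball q \<delta> \<noteq> {}})"
  proof
    fix z assume "z \<in> {z\<in>X. ball_of z \<inter> A \<noteq> {}}"
    then obtain p where "z \<in> X" "p \<in> ball_of z" "p \<in> A" by auto
    moreover from this F(3) closure_subset obtain q where "q \<in> F" "p \<in> ball q \<delta>" by blast
    ultimately show "z \<in> (\<Union>q\<in>F. {z\<in>X. ball_of z \<inter> ball q \<delta> \<noteq> {}})" by blast
  qed
  then show ?thesis using F(2) one by (meson finite_UN_I finite_subset)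
qed

lemma closed_cover:
  assumes "Y \<subseteq> X"
  shows "closed (cover Y)"
  unfolding closed_def open_contains_ball
proof
  fix x assume x: "x \<in> - cover Y"
  define F where "F = {z\<in>Y. ball_of z \<inter> ball x 1 \<noteq> {}}"
  have "finite F" using finite_balls_meeting[of "ball x 1"] assms
    by (auto simp: F_def intro: finite_subset[rotated])
  then have "closed (cover F)" by (auto simp: cover_def)
  moreover have "x \<notin> cover F" using x by (auto simp: cover_def F_def)
  ultimately obtain d where d: "d > 0" "ball x d \<subseteq> - cover F"
    using open_contains_ball[of "- cover F"] by (auto simp: closed_def)
  have "ball x (min d 1) \<subseteq> - cover Y"
  proof
    fix p assume p: "p \<in> ball x (min d 1)"
    show "p \<in> - cover Y"
    proof
      assume "p \<in> cover Y"
      then obtain z where "z \<in> Y" "p \<in> ball_of z" by (auto simp: cover_def)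
      moreover from this p have "z \<in> F" by (auto simp: F_def)
      ultimately have "p \<in> cover F" by (auto simp: cover_def)
      then show False using p d by auto
    qed
  qed
  then show "\<exists>e>0. ball x e \<subseteq> - cover Y" using d by (intro exI[of _ "min d 1"]) auto
qed

text \<open>
  The balls on chains from \<open>(q, \<delta>)\<close> and the remaining balls have disjoint closed unions, so a
  connected set of occupied points cannot leave the former. This is where chains of finite length
  capture topological components.
\<close>

lemma component_subset_ball:
  assumes C: "C \<in> components (cover X)" and p: "p \<in> C" "dist q p \<le> \<delta>"
    and L: "\<not> reach X q \<delta> L"
  shows "C \<subseteq> ball q L"
proof -
  define Y where "Y = {z\<in>X. \<exists>ws. set ws \<subseteq> X \<and> successively touch ((q, \<delta>) # ws @ [z])}"
  have YX: "Y \<subseteq> X" by (auto simp: Y_def)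
  have sub: "cover Y \<subseteq> ball q L"
    using reach_bound[OF L] by (fastforce simp: cover_def Y_def)
  have C': "connected C" "C \<subseteq> cover X"
    using in_components_connected[OF C] in_components_subset[OF C] .
  have split: "cover X = cover Y \<union> cover (X - Y)" using YX by (auto simp: cover_def)
  have disj: "cover Y \<inter> cover (X - Y) = {}"
  proof (rule ccontr)
    assume "cover Y \<inter> cover (X - Y) \<noteq> {}"
    then obtain z w where zw: "z \<in> Y" "w \<in> X" "w \<notin> Y" "ball_of z \<inter> ball_of w \<noteq> {}"
      unfolding cover_def by blast
    then have "touch z w" using YX radius_nonneg by (subst touch_iff_meet) auto
    moreover obtain ws where "set ws \<subseteq> X" "successively touch ((q, \<delta>) # ws @ [z])"
      using zw by (auto simp: Y_def)
    ultimately have "set (ws @ [z]) \<subseteq> X \<and> successively touch ((q, \<delta>) # (ws @ [z]) @ [w])"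
      using zw YX successively_append_iff[of touch "(q, \<delta>) # ws @ [z]" "[w]"] by auto
    then have "w \<in> Y" unfolding Y_def using zw(2) by (intro CollectI conjI exI[of _ "ws @ [z]"]) auto
    then show False using zw by simp
  qed
  obtain z where z: "z \<in> X" "p \<in> ball_of z" using p C' by (auto simp: cover_def)
  have "touch (q, \<delta>) z"
    using z p delta_pos radius_nonneg by (subst touch_iff_meet) auto
  then have "z \<in> Y" using z unfolding Y_def by (auto intro!: exI[of _ "[]"])
  then have "cover Y \<inter> C \<noteq> {}" using z p unfolding cover_def by blast
  then have "cover (X - Y) \<inter> C = {}"
    using C' closed_cover[OF YX] closed_cover[of "X - Y"] disj split
    unfolding connected_closed by blast
  then show ?thesis using C' split sub by blast
qed

lemma bounded_component:
  assumes "C \<in> components (cover X)"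
  shows "bounded C"
proof -
  obtain p where "p \<in> C" using assms in_components_nonempty by blast
  moreover obtain q where "q \<in> D" "dist q p < \<delta>" using D_dense by blast
  moreover obtain L where "\<not> reach X q \<delta> L" using D_bounded_reach \<open>q \<in> D\<close> by blast
  ultimately show ?thesis
    using component_subset_ball[OF assms] bounded_subset[OF bounded_ball]
    by (metis less_imp_le)
qed

lemma Union_components_eq_cover:
  assumes "\<And>C. C \<in> \<C> \<Longrightarrow> C \<in> components (cover X)"
  shows "\<Union>\<C> = cover {z\<in>X. connected_component_set (cover X) (fst z) \<in> \<C>}"
proof -
  have in_comp: "ball_of z \<subseteq> connected_component_set (cover X) (fst z)" if "z \<in> X" for z
    using that radius_nonneg
    by (intro connected_component_maximal) (auto simp: cover_def convex_connected)
  show ?thesis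
  proof (intro equalityI subsetI)
    fix p assume "p \<in> \<Union>\<C>"
    then obtain C where C: "C \<in> \<C>" "p \<in> C" by blast
    then have "C \<subseteq> cover X" "C = connected_component_set (cover X) p"
      using assms in_components_subset by (blast, metis components_iff connected_component_eq)
    moreover from this C obtain z where z: "z \<in> X" "p \<in> ball_of z" by (auto simp: cover_def)
    moreover have "connected_component_set (cover X) p = connected_component_set (cover X) (fst z)"
      using in_comp z connected_component_eq by blast
    ultimately show "p \<in> cover {z\<in>X. connected_component_set (cover X) (fst z) \<in> \<C>}"
      using C \<open>C = connected_component_set (cover X) p\<close> unfolding cover_def
      by (intro UN_I[of z]) simp_all
  next
    fix p assume "p \<in> cover {z\<in>X. connected_component_set (cover X) (fst z) \<in> \<C>}"
    then obtain z where "z \<in> X" "connected_component_set (cover X) (fst z) \<in> \<C>" "p \<in> ball_of z"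
      unfolding cover_def by blast
    then show "p \<in> \<Union>\<C>" using in_comp by blast
  qed
qed

text \<open>
  Let \<open>S\<close> be the union of \<open>cball 0 R\<close> and the clusters that meet it. A vacant point \<open>a\<close> close to the
  outer boundary of \<open>S\<close> is cut off by no single cluster: either the cluster is part of \<open>S\<close>
  and \<open>a\<close> lies outside of it, or it is disjoint from \<open>S\<close> and \<open>a\<close> is joined to the origin through
  \<open>S\<close>.
\<close>

lemma ex_outer_point:
  assumes R: "0 < R"
  obtains a where "a \<notin> cover X" "R < norm a"
    "\<And>C. C \<in> components (cover X) \<Longrightarrow> C \<inter> cball 0 R \<noteq> {} \<Longrightarrow> a \<in> outside C"
    "\<And>C. C \<in> components (cover X) \<Longrightarrow> C \<inter> cball 0 R = {} \<Longrightarrow> connected_component (- C) a 0"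
proof -
  define near where "near = {C \<in> components (cover X). C \<inter> cball 0 R \<noteq> {}}"
  define far where "far = {C \<in> components (cover X). C \<inter> cball 0 R = {}}"
  define S where "S = cball 0 R \<union> \<Union>near"
  have closed: "closed (\<Union>near)" "closed (\<Union>far)"
    by (subst Union_components_eq_cover; auto simp: near_def far_def intro: closed_cover)+
  have "near \<subseteq> (\<lambda>z. connected_component_set (cover X) (fst z)) ` {z\<in>X. ball_of z \<inter> cball 0 R \<noteq> {}}"
  proof
    fix C assume C: "C \<in> near"
    then obtain p where p: "p \<in> C" "p \<in> cball 0 R" by (auto simp: near_def)
    then have "p \<in> cover {z\<in>X. connected_component_set (cover X) (fst z) \<in> {C}}"
      using C Union_components_eq_cover[of "{C}"] by (auto simp: near_def)
    then obtain z where "z \<in> X" "connected_component_set (cover X) (fst z) = C" "p \<in> ball_of z"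
      by (auto simp: cover_def)
    then show "C \<in> (\<lambda>z. connected_component_set (cover X) (fst z)) ` {z\<in>X. ball_of z \<inter> cball 0 R \<noteq> {}}"
      using p by blast
  qed
  then have "finite near" using finite_balls_meeting[of "cball 0 R"] finite_surj by blast
  then have "bounded S" unfolding S_def using bounded_component by (auto simp: near_def)
  have "closed S" using closed by (auto simp: S_def)
  have "connected S"
  proof -
    have "S = \<Union>((\<lambda>C. cball 0 R \<union> C) ` insert {} near)" by (auto simp: S_def)
    moreover have "connected (\<Union>((\<lambda>C. cball 0 R \<union> C) ` insert {} near))"
    proof (rule connected_Union)
      show "\<Inter>((\<lambda>C. cball 0 R \<union> C) ` insert {} near) \<noteq> {}"
        using R by (auto intro!: exI[of _ 0])
      fix s assume "s \<in> (\<lambda>C. cball 0 R \<union> C) ` insert {} near"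
      then obtain C where "s = cball 0 R \<union> C" "C = {} \<or> C \<in> near" by blast
      moreover have "connected (cball (0::'a) R)" by (simp add: convex_connected)
      ultimately show "connected s"
        by (cases "C = {}")
          (auto simp: near_def Int_commute intro!: connected_Un dest: in_components_connected)
    qed
    ultimately show ?thesis by simp
  qed
  \<comment> \<open>a boundary point of \<open>outside S\<close> belongs to \<open>S\<close> and has a neighbourhood free of other clusters\<close>
  have out: "outside S \<noteq> {}" "outside S \<inter> S = {}"
    using outside_bounded_nonempty[OF \<open>bounded S\<close>] outside_no_overlap by auto
  moreover have "0 \<in> S" using R by (simp add: S_def)
  ultimately have "outside S \<noteq> UNIV" by blast
  then obtain z where z: "z \<in> frontier (outside S)" using out frontier_eq_empty by blast
  have "z \<in> S" using z frontier_outside_subset[OF \<open>closed S\<close>] by blast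
  have "S \<inter> \<Union>far = {}"
  proof -
    have "C \<inter> C' = {}" if "C \<in> near" "C' \<in> far" for C C'
    proof -
      have "C \<noteq> C'" using that by (auto simp: near_def far_def)
      then show ?thesis
        using that components_nonoverlap[of C "cover X" C'] by (auto simp: near_def far_def)
    qed
    moreover have "cball 0 R \<inter> C' = {}" if "C' \<in> far" for C' using that by (auto simp: far_def)
    ultimately show ?thesis unfolding S_def by blast
  qed
  then have "z \<in> - \<Union>far" using \<open>z \<in> S\<close> by blast
  then obtain d where d: "0 < d" "ball z d \<subseteq> - \<Union>far"
    using closed(2) by (metis closed_def open_contains_ball)
  obtain a where a: "a \<in> outside S" "dist a z < d"
    using z d(1) closure_approachable[of z "outside S"] by (auto simp: frontier_def)
  have cov: "cover X = \<Union>near \<union> \<Union>far"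
  proof -
    have "near \<union> far = components (cover X)" by (auto simp: near_def far_def)
    then show ?thesis using Union_components[of "cover X"] by (metis Union_Un_distrib)
  qed
  have aball: "a \<in> ball z d" using a by (simp add: dist_commute)
  have aS: "a \<notin> S" using a out by blast
  show thesis
  proof (rule that)
    show "a \<notin> cover X" using aball aS d cov by (auto simp: S_def)
    show "R < norm a" using aS by (auto simp: S_def)
    show "a \<in> outside C" if "C \<in> components (cover X)" "C \<inter> cball 0 R \<noteq> {}" for C
      using a outside_mono[of C S] that by (auto simp: S_def near_def)
    show "connected_component (- C) a 0" if "C \<in> components (cover X)" "C \<inter> cball 0 R = {}" for C
    proof -
      have C: "C \<in> far" using that by (simp add: far_def)
      have "connected (S \<union> ball z d)"
        using \<open>connected S\<close> \<open>z \<in> S\<close> d by (intro connected_Un) auto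
      moreover have "S \<union> ball z d \<subseteq> - C" using C d \<open>S \<inter> \<Union>far = {}\<close> by blast
      moreover have "0 \<in> S \<union> ball z d" using R by (auto simp: S_def)
      ultimately show ?thesis using aball unfolding connected_component_def by blast
    qed
  qed
qed

text \<open>
  The points given by \<open>ex_outer_point\<close> for two radii \<open>R0 \<le> R\<close> lie in the same component of the
  vacant region, since no cluster separates them. The only case that needs the ray is a cluster
  between the two balls, that is, one that meets the larger ball but not the smaller one; it could
  separate the points only by surrounding the origin.
\<close>

lemma vacant_percolates:
  assumes dim: "2 \<le> DIM('a)" and e: "norm e = 1"
    and ray: "\<And>j. j0 \<le> j \<Longrightarrow> \<not> reach X ((real j * \<delta>) *\<^sub>R e) \<delta> (real j * \<delta>)"
  shows "percolates (- cover X)"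
proof -
  define R0 where "R0 = (real j0 + 1) * \<delta>"
  have R0: "0 < R0" using delta_pos by (simp add: R0_def)
  have not_enclosing: "0 \<in> outside C"
    if C: "C \<in> components (cover X)" "C \<inter> cball 0 R0 = {}" for C
  proof (cases "\<exists>t\<ge>0. t *\<^sub>R e \<in> C")
    case True
    then obtain t where t: "0 \<le> t" "t *\<^sub>R e \<in> C" by blast
    then have "R0 < t" using C(2) e by (auto simp: disjoint_iff)
    \<comment> \<open>the grid point before \<open>t\<close>; chains from it stay in a ball whose boundary contains the origin\<close>
    define j where "j = nat \<lfloor>t / \<delta>\<rfloor>"
    have j: "real j \<le> t / \<delta>" "t / \<delta> < real j + 1"
      using t delta_pos by (auto simp: j_def)
    then have jd: "real j * \<delta> \<le> t" "t < real j * \<delta> + \<delta>"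
      using delta_pos by (auto simp: field_simps)
    have "real j0 + 1 < t / \<delta>" using \<open>R0 < t\<close> delta_pos by (simp add: R0_def field_simps)
    then have "j0 \<le> j" using j by linarith
    define q where "q = (real j * \<delta>) *\<^sub>R e"
    have "dist q (t *\<^sub>R e) = norm ((real j * \<delta> - t) *\<^sub>R e)"
      by (simp add: q_def dist_norm scaleR_diff_left)
    then have "dist q (t *\<^sub>R e) \<le> \<delta>" using e jd by simp
    then have "C \<subseteq> ball q (real j * \<delta>)"
      using component_subset_ball[OF C(1) t(2)] ray[OF \<open>j0 \<le> j\<close>] by (simp add: q_def)
    moreover have "0 \<in> outside (ball q (real j * \<delta>))"
      using e delta_pos by (subst outside_convex) (auto simp: q_def)
    ultimately show ?thesis using outside_mono by blast
  next
    case False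
    define ray where "ray = (\<lambda>t. t *\<^sub>R e) ` {0..}"
    have "connected ray" unfolding ray_def
      by (intro connected_continuous_image continuous_intros) auto
    moreover have "0 \<in> ray" "ray \<subseteq> - C" using False by (auto simp: ray_def)
    ultimately have "ray \<subseteq> connected_component_set (- C) 0"
      by (intro connected_component_maximal)
    moreover have "\<not> bounded ray"
    proof
      assume "bounded ray"
      then obtain B where B: "\<And>x. x \<in> ray \<Longrightarrow> norm x \<le> B" by (auto simp: bounded_iff)
      have "norm ((\<bar>B\<bar> + 1) *\<^sub>R e) \<le> B" by (rule B) (auto simp: ray_def)
      then show False using e by auto
    qed
    ultimately have "\<not> bounded (connected_component_set (- C) 0)" using bounded_subset by blast
    then show ?thesis using \<open>0 \<in> ray\<close> \<open>ray \<subseteq> - C\<close> by (auto simp: outside)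
  qed
  have outside_connected: "connected_component (- C) u v"
    if "C \<in> components (cover X)" "u \<in> outside C" "v \<in> outside C" for C u v
    using connected_outside[OF bounded_component[OF that(1)] dim] that outside_no_overlap[of C]
    unfolding connected_component_def by (intro exI[of _ "outside C"]) blast
  obtain a where a: "a \<notin> cover X"
    and a_near: "\<And>C. C \<in> components (cover X) \<Longrightarrow> C \<inter> cball 0 R0 \<noteq> {} \<Longrightarrow> a \<in> outside C"
    and a_far: "\<And>C. C \<in> components (cover X) \<Longrightarrow> C \<inter> cball 0 R0 = {} \<Longrightarrow> connected_component (- C) a 0"
    using ex_outer_point[OF R0] by metis
  have "\<exists>b. R < norm b \<and> b \<in> connected_component_set (- cover X) a" if R: "R0 \<le> R" for R
  proof -
    obtain b where b: "R < norm b"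
      and b_near: "\<And>C. C \<in> components (cover X) \<Longrightarrow> C \<inter> cball 0 R \<noteq> {} \<Longrightarrow> b \<in> outside C"
      and b_far: "\<And>C. C \<in> components (cover X) \<Longrightarrow> C \<inter> cball 0 R = {} \<Longrightarrow> connected_component (- C) b 0"
      using ex_outer_point[of R] R R0 by (metis less_le_trans)
    have "connected_component (- C) a b" if C: "C \<in> components (cover X)" for C
    proof (cases "C \<inter> cball 0 R0 = {}")
      case True
      then have "connected_component (- C) a 0" using a_far C by blast
      moreover have "connected_component (- C) 0 b"
      proof (cases "C \<inter> cball 0 R = {}")
        case True
        then show ?thesis using b_far C connected_component_sym by blast
      next
        case False
        then show ?thesis
          using b_near[OF C] not_enclosing[OF C \<open>C \<inter> cball 0 R0 = {}\<close>] outside_connected[OF C] by blast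
      qed
      ultimately show ?thesis by (rule connected_component_trans)
    next
      case False
      moreover from this R have "C \<inter> cball 0 R \<noteq> {}" by fastforce
      ultimately show ?thesis using a_near[OF C] b_near[OF C] outside_connected[OF C] by blast
    qed
    then have "connected_component (- cover X) a b"
      using separation_by_component_closed_pointwise[OF closed_cover[OF order_refl]] by metis
    then show ?thesis using b by auto
  qed
  then have unb: "\<not> bounded (connected_component_set (- cover X) a)"
    unfolding bounded_iff by (metis linorder_not_le max.cobounded1 max.cobounded2 order_trans)
  moreover have "connected_component_set (- cover X) a \<in> components (- cover X)"
    using a by (intro componentsI) auto
  ultimately show ?thesis unfolding percolates_def by blast
qed

end

section \<open>The space of configurations\<close>

definition avoid :: "'b set \<Rightarrow> 'b set set" where
  "avoid B = {X. X \<inter> B = {}}"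

definition regions :: "('a::euclidean_space \<times> real) set set" where
  "regions = {B \<in> sets borel. bounded (fst ` B)}"

text \<open>
  The generators use regions with bounded projection, as the avoidance probability of such a region is
  computed from the points in a bounded set.
\<close>

definition configurations :: "('a::euclidean_space \<times> real) set measure" where
  "configurations = sigma UNIV (avoid ` regions)"

lemma space_configurations [simp]: "space configurations = UNIV"
  by (simp add: configurations_def space_measure_of_conv)

lemma sets_configurations: "sets configurations = sigma_sets UNIV (avoid ` regions)"
  by (simp add: configurations_def)

lemma avoid_Un: "avoid A \<inter> avoid B = avoid (A \<union> B)"
  by (auto simp: avoid_def)

lemma regions_Un: "A \<in> regions \<Longrightarrow> B \<in> regions \<Longrightarrow> A \<union> B \<in> regions"
  by (auto simp: regions_def image_Un)

lemma regions_Diff: "A \<in> regions \<Longrightarrow> B \<in> sets borel \<Longrightarrow> A - B \<in> regions"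
  by (auto simp: regions_def elim!: bounded_subset)

lemma sets_cylinder [measurable]: "A \<in> sets borel \<Longrightarrow> A \<times> UNIV \<in> sets (borel :: ('a::euclidean_space \<times> real) measure)"
  by (auto simp: borel_prod[symmetric])

lemma sets_avoid:
  assumes "B \<in> sets borel"
  shows "avoid B \<in> sets configurations"
proof -
  have "avoid B = (\<Inter>n. avoid (B \<inter> ball 0 (real n) \<times> UNIV))"
  proof (intro equalityI subsetI)
    fix X assume X: "X \<in> (\<Inter>n. avoid (B \<inter> ball 0 (real n) \<times> UNIV))"
    show "X \<in> avoid B" unfolding avoid_def
    proof clarify
      show "X \<inter> B = {}"
      proof (rule ccontr)
        assume "X \<inter> B \<noteq> {}"
        then obtain z where z: "z \<in> X" "z \<in> B" by blast
        obtain n where "norm (fst z) < real n" using reals_Archimedean2 by blast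
        then have "z \<in> B \<inter> ball 0 (real n) \<times> UNIV" using z by (cases z) auto
        then show False using X z unfolding avoid_def by blast
      qed
    qed
  qed (auto simp: avoid_def)
  moreover have "avoid (B \<inter> ball 0 (real n) \<times> UNIV) \<in> sets configurations" for n
  proof -
    have "bounded (fst ` (B \<inter> ball 0 (real n) \<times> UNIV))"
      by (rule bounded_subset[OF bounded_ball[of 0 "real n"]]) auto
    then have "B \<inter> ball 0 (real n) \<times> UNIV \<in> regions"
      using assms by (auto simp: regions_def)
    then show ?thesis unfolding sets_configurations by (intro sigma_sets.Basic imageI)
  qed
  ultimately show ?thesis by auto
qed

lemma measurable_configurations:
  fixes f :: "'b \<Rightarrow> ('a::euclidean_space \<times> real) set"
  assumes "\<And>B. B \<in> regions \<Longrightarrow> {\<omega> \<in> space N. f \<omega> \<inter> B = {}} \<in> sets N"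
  shows "f \<in> measurable N configurations"
  unfolding configurations_def
proof (rule measurable_measure_of)
  fix A assume "A \<in> avoid ` (regions :: ('a \<times> real) set set)"
  then obtain B :: "('a \<times> real) set" where B: "A = avoid B" "B \<in> regions" by blast
  have "f -` A \<inter> space N = {\<omega> \<in> space N. f \<omega> \<inter> B = {}}" by (auto simp: avoid_def B)
  then show "f -` A \<inter> space N \<in> sets N" using assms[OF B(2)] by simp
qed auto

lemma measurable_Int_configurations:
  "T \<in> sets borel \<Longrightarrow> (\<lambda>X. X \<inter> T) \<in> measurable configurations configurations"
  using sets_avoid[of "T \<inter> B" for B]
  by (intro measurable_configurations) (auto simp: avoid_def regions_def Int_assoc)

lemma measurable_Diff_configurations:
  assumes "T \<in> sets borel"
  shows "(\<lambda>X. X - T) \<in> measurable configurations configurations"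
  using measurable_Int_configurations[of "- T"] assms by (simp add: Diff_eq borel_comp)

lemma translate_regions:
  assumes B: "B \<in> regions"
  shows "(\<lambda>z. (fst z + c, snd z)) -` B \<in> (regions :: ('a::euclidean_space \<times> real) set set)"
proof -
  have "(\<lambda>z. (fst z + c, snd z)) \<in> borel_measurable (borel :: ('a \<times> real) measure)"
    by (intro borel_measurable_continuous_onI continuous_intros)
  from measurable_sets[OF this, of B]
  have "(\<lambda>z. (fst z + c, snd z)) -` B \<in> sets borel" using B by (simp add: regions_def)
  moreover have "fst ` ((\<lambda>z. (fst z + c, snd z)) -` B) \<subseteq> (\<lambda>x. x - c) ` fst ` B" by force
  then have "bounded (fst ` ((\<lambda>z. (fst z + c, snd z)) -` B))"
    by (rule bounded_subset[rotated]) (use B in \<open>auto simp: regions_def intro: bounded_translation_minus\<close>)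
  ultimately show ?thesis by (simp add: regions_def)
qed

lemma measurable_translate_configurations:
  "(\<lambda>X. (\<lambda>z. (fst z + c, snd z)) ` X) \<in> measurable configurations configurations"
proof (rule measurable_configurations)
  fix B :: "('a \<times> real) set" assume B: "B \<in> regions"
  have "(\<lambda>z. (fst z + c, snd z)) -` B \<in> sets borel"
    using translate_regions[OF B, of c] by (simp add: regions_def)
  from sets_avoid[OF this]
  have "avoid ((\<lambda>z. (fst z + c, snd z)) -` B) \<in> sets configurations" .
  also have "avoid ((\<lambda>z. (fst z + c, snd z)) -` B) =
      {X \<in> space configurations. (\<lambda>z. (fst z + c, snd z)) ` X \<inter> B = {}}"
    by (auto simp: avoid_def)
  finally show "{X \<in> space configurations. (\<lambda>z. (fst z + c, snd z)) ` X \<inter> B = {}} \<in> sets configurations" .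
qed

lemma configurations_measure_eqI:
  assumes "finite_measure M" "sets M = sets configurations" "sets N = sets configurations"
    and eq: "\<And>B. B \<in> regions \<Longrightarrow> emeasure M (avoid B) = emeasure N (avoid B)"
  shows "M = N"
proof (rule measure_eqI_generator_eq[where E = "avoid ` regions" and \<Omega> = UNIV and A = "\<lambda>_. UNIV"])
  show "Int_stable (avoid ` regions)"
    by (auto simp: Int_stable_def avoid_Un intro!: imageI regions_Un)
  have "UNIV = avoid {}" by (auto simp: avoid_def)
  then show "range (\<lambda>_. UNIV) \<subseteq> avoid ` regions" by (auto simp: regions_def)
  show "emeasure M UNIV \<noteq> \<infinity>" using assms(1) finite_measure.emeasure_finite by auto
qed (use assms in \<open>auto simp: sets_configurations\<close>)

section \<open>Measurability of the reach of chains\<close>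

text \<open>
  The existence of points that satisfy a strict inequality between continuous functions can be
  expressed by countably many events that open sets contain a point, but the conditions on a chain
  are closed inequalities. Their largest violation along \<open>z # ws\<close> is a continuous function of the
  balls. A chain satisfies the conditions iff this defect is at most \<open>0\<close>; as the finitely many
  balls centred in a bounded window give only finitely many values, \<open>\<le> 0\<close> may be replaced there by
  \<open>< 1 / n\<close> for all \<open>n\<close>.
\<close>

fun defect :: "'a::metric_space \<Rightarrow> real \<Rightarrow> 'a \<times> real \<Rightarrow> ('a \<times> real) list \<Rightarrow> real" where
  "defect x L z [] = L - dist x (fst z) - snd z"
| "defect x L z (w # ws) = max (dist (fst z) (fst w) - snd z - snd w) (defect x L w ws)"

lemma defect_le_0_iff:
  "defect x L z ws \<le> 0 \<longleftrightarrow> successively touch (z # ws) \<and>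
    L \<le> dist x (fst (last (z # ws))) + snd (last (z # ws))"
  by (induction ws arbitrary: z) (auto simp: touch_def)

lemma defect_perturb:
  assumes "dist z z' \<le> e" "list_all2 (\<lambda>w w'. dist w w' \<le> e) ws ws'"
  shows "defect x L z' ws' \<le> defect x L z ws + 4 * e"
  using assms(2,1)
proof (induction ws ws' arbitrary: z z' rule: list_all2_induct)
  case Nil
  have "dist (fst z) (fst z') \<le> e" "dist (snd z) (snd z') \<le> e"
    using Nil dist_fst_le[of z z'] dist_snd_le[of z z'] by linarith+
  moreover have "dist x (fst z) \<le> dist x (fst z') + dist (fst z) (fst z')"
    by (metis dist_commute dist_triangle)
  moreover have "0 \<le> e" using Nil zero_le_dist order_trans by blast
  ultimately show ?case by (simp add: dist_real_def)
next
  case (Cons w ws w' ws')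
  have "dist (fst z) (fst z') \<le> e" "dist (snd z) (snd z') \<le> e"
    using Cons.prems dist_fst_le[of z z'] dist_snd_le[of z z'] by linarith+
  moreover have "dist (fst w) (fst w') \<le> e" "dist (snd w) (snd w') \<le> e"
    using Cons.hyps dist_fst_le[of w w'] dist_snd_le[of w w'] by linarith+
  moreover have "dist (fst z') (fst w') \<le> dist (fst z) (fst z') + dist (fst z) (fst w) + dist (fst w) (fst w')"
    by (smt (verit) dist_commute dist_triangle)
  moreover have "defect x L w' ws' \<le> defect x L w ws + 4 * e" using Cons by blast
  ultimately show ?case unfolding defect.simps dist_real_def by linarith
qed

lemma finite_range_defect:
  assumes "finite Y" "z \<in> Y"
  shows "finite {defect x L z ws |ws. set ws \<subseteq> Y}"
proof -
  define V where "V = (\<lambda>(z, w). dist (fst z) (fst w) - snd z - snd w) ` (Y \<times> Y) \<union>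
    (\<lambda>z. L - dist x (fst z) - snd z) ` Y"
  have "defect x L z ws \<in> V" if "set ws \<subseteq> Y" "z \<in> Y" for z ws
    using that
  proof (induction ws arbitrary: z)
    case (Cons w ws)
    then have "defect x L w ws \<in> V" "dist (fst z) (fst w) - snd z - snd w \<in> V"
      by (auto simp: V_def)
    then show ?case by (simp add: max_def)
  qed (auto simp: V_def)
  then have "{defect x L z ws |ws. set ws \<subseteq> Y} \<subseteq> V" using assms by blast
  moreover have "finite V" using assms by (simp add: V_def)
  ultimately show ?thesis by (rule finite_subset)
qed

text \<open>
  A chain whose defect is less than \<open>e\<close> has a neighbourhood of such chains, and this contains a
  product of small balls centred in a countable dense set. So the event is a countable union, over
  lists of such balls, of the events that each ball in the list contains a point.
\<close>

lemma sets_ex_defect_less: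
  fixes x :: "'a::euclidean_space"
  shows "{X. \<exists>ws. set ws \<subseteq> X \<and> defect x L z ws < e} \<in> sets configurations"
proof -
  obtain D :: "('a \<times> real) set" where D: "countable D" "\<And>U. open U \<Longrightarrow> U \<noteq> {} \<Longrightarrow> \<exists>d\<in>D. d \<in> U"
    using countable_dense_exists by metis
  define Q where "Q n = {qs \<in> lists D.
    \<forall>ws. list_all2 (\<lambda>q w. dist q w < 1 / real (Suc n)) qs ws \<longrightarrow> defect x L z ws < e}" for n
  have "countable (Q n)" for n
    using D(1) by (auto simp: Q_def intro: countable_subset[OF _ countable_lists[OF D(1)]])
  moreover have "(\<Inter>q\<in>set qs. - avoid (ball q (1 / real (Suc n)))) \<in> sets configurations" for qs :: "('a \<times> real) list" and n
  proof (cases "qs = []")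
    case True
    have "UNIV \<in> sets (configurations :: ('a \<times> real) set measure)"
      using sets.top[of "configurations :: ('a \<times> real) set measure"] by simp
    with True show ?thesis by simp
  next
    case False
    have "- avoid (ball q (1 / real (Suc n))) \<in> sets configurations" for q :: "'a \<times> real"
      using sets.compl_sets[OF sets_avoid[of "ball q (1 / real (Suc n))"]]
      by (simp add: Compl_eq_Diff_UNIV)
    then show ?thesis using False by (intro sets.finite_INT) auto
  qed
  ultimately have "(\<Union>n. \<Union>qs\<in>Q n. \<Inter>q\<in>set qs. - avoid (ball q (1 / real (Suc n)))) \<in> sets configurations"
    by (intro sets.countable_UN'' sets.countable_UN) auto
  also have "(\<Union>n. \<Union>qs\<in>Q n. \<Inter>q\<in>set qs. - avoid (ball q (1 / real (Suc n)))) =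
    {X. \<exists>ws. set ws \<subseteq> X \<and> defect x L z ws < e}"
  proof (intro equalityI subsetI)
    fix X assume "X \<in> (\<Union>n. \<Union>qs\<in>Q n. \<Inter>q\<in>set qs. - avoid (ball q (1 / real (Suc n))))"
    then obtain n qs where qs: "qs \<in> Q n" "\<And>q. q \<in> set qs \<Longrightarrow> X \<notin> avoid (ball q (1 / real (Suc n)))"
      by blast
    then have "\<forall>q\<in>set qs. \<exists>w. w \<in> X \<and> dist q w < 1 / real (Suc n)"
      unfolding avoid_def by fastforce
    then obtain f where f: "\<And>q. q \<in> set qs \<Longrightarrow> f q \<in> X \<and> dist q (f q) < 1 / real (Suc n)"
      by metis
    have "defect x L z (map f qs) < e"
      using qs(1) f unfolding Q_def by (auto simp: list_all2_map2 list_all2_same)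
    then show "X \<in> {X. \<exists>ws. set ws \<subseteq> X \<and> defect x L z ws < e}"
      using f by (intro CollectI exI[of _ "map f qs"]) auto
  next
    fix X assume "X \<in> {X. \<exists>ws. set ws \<subseteq> X \<and> defect x L z ws < e}"
    then obtain ws where ws: "set ws \<subseteq> X" "defect x L z ws < e" by blast
    define c where "c = (e - defect x L z ws) / 8"
    have "0 < c" using ws by (simp add: c_def)
    then obtain n where n: "1 / real (Suc n) < c"
      using reals_Archimedean by (metis inverse_eq_divide)
    define m where "m = 1 / real (Suc n)"
    have "0 < m" by (simp add: m_def)
    have "\<forall>w. \<exists>d\<in>D. dist d w < m"
      using D(2)[of "ball w m" for w] \<open>0 < m\<close> by (auto simp: dist_commute)
    then obtain f where f: "\<And>w. f w \<in> D" "\<And>w. dist (f w) w < m" by metis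
    have "map f ws \<in> Q n"
    proof -
      have "defect x L z ws' < e" if "list_all2 (\<lambda>q w. dist q w < m) (map f ws) ws'" for ws'
      proof -
        have "list_all2 (\<lambda>w w'. dist w w' \<le> 2 * m) ws ws'"
          using that unfolding list_all2_map1
        proof (rule list_all2_mono)
          fix w w' assume "dist (f w) w' < m"
          then show "dist w w' \<le> 2 * m" using f(2)[of w] dist_triangle3[of w w' "f w"] by linarith
        qed
        then have "defect x L z ws' \<le> defect x L z ws + 4 * (2 * m)"
          using \<open>0 < m\<close> by (intro defect_perturb) auto
        then show ?thesis using n by (simp add: c_def m_def)
      qed
      then show ?thesis using f by (auto simp: Q_def m_def)
    qed
    moreover have "X \<notin> avoid (ball (f w) (1 / real (Suc n)))" if "w \<in> set ws" for w
      using f(2)[of w] that ws(1) by (auto simp: avoid_def m_def)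
    ultimately show "X \<in> (\<Union>n. \<Union>qs\<in>Q n. \<Inter>q\<in>set qs. - avoid (ball q (1 / real (Suc n))))"
      by (intro UN_I[of n] UN_I[of "map f ws"]) auto
  qed
  finally show ?thesis .
qed

text \<open>
  The window \<open>ball 0 R\<close> makes the pigeonhole argument of \<open>reach_event_iff\<close> available. For
  configurations that are not locally finite, \<open>reach_event\<close> may differ from \<open>reach\<close>.
\<close>

definition reach_event :: "'a::euclidean_space \<Rightarrow> real \<Rightarrow> real \<Rightarrow> ('a \<times> real) set set" where
  "reach_event x \<delta> L = {X. \<exists>R::nat. \<forall>i::nat.
    \<exists>ws. set ws \<subseteq> X \<inter> ball 0 (real R) \<times> UNIV \<and> defect x L (x, \<delta>) ws < 1 / real (Suc i)}"

lemma sets_reach_event [measurable]: "reach_event x \<delta> L \<in> sets configurations"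
proof -
  have "{X \<in> space configurations. \<exists>ws. set ws \<subseteq> X \<inter> ball 0 (real R) \<times> UNIV \<and> defect x L (x, \<delta>) ws < 1 / real (Suc i)}
    \<in> sets configurations" for R i
    using measurable_sets[OF measurable_Int_configurations[of "ball 0 (real R) \<times> UNIV"]
      sets_ex_defect_less[of x L "(x, \<delta>)" "1 / real (Suc i)"]] sets_cylinder[of "ball 0 (real R)"]
    by (simp add: vimage_def)
  from sets.sets_Collect_countable_Ex[OF sets.sets_Collect_countable_All[OF this]]
  show ?thesis by (simp add: reach_event_def)
qed

lemma reach_event_iff:
  assumes "locally_finite_set X"
  shows "X \<in> reach_event x \<delta> L \<longleftrightarrow> reach X x \<delta> L"
proof
  assume "X \<in> reach_event x \<delta> L"
  then obtain R :: nat where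
    R: "\<And>i. \<exists>ws. set ws \<subseteq> X \<inter> ball 0 (real R) \<times> UNIV \<and> defect x L (x, \<delta>) ws < 1 / real (Suc i)"
    unfolding reach_event_def by blast
  define Y where "Y = X \<inter> ball 0 (real R) \<times> UNIV"
  define V where "V = {defect x L (x, \<delta>) ws |ws. set ws \<subseteq> Y}"
  have "Y \<subseteq> {z\<in>X. norm (fst z) \<le> real R}" by (auto simp: Y_def)
  then have "finite Y" using assms finite_subset unfolding locally_finite_set_def by blast
  then have "finite V"
    using finite_range_defect[of "insert (x, \<delta>) Y" "(x, \<delta>)" x L]
    by (auto simp: V_def elim!: finite_subset[rotated])
  have "\<exists>v\<in>V. v \<le> 0"
  proof (rule ccontr)
    assume neg: "\<not> (\<exists>v\<in>V. v \<le> 0)"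
    have "V \<noteq> {}" by (auto simp: V_def intro: exI[of _ "[]"])
    then have "0 < Min V" using neg \<open>finite V\<close> by (auto simp: not_le)
    then obtain i where "1 / real (Suc i) < Min V"
      using reals_Archimedean by (metis inverse_eq_divide)
    moreover obtain ws where "set ws \<subseteq> Y" "defect x L (x, \<delta>) ws < 1 / real (Suc i)"
      using R[of i] by (auto simp: Y_def)
    moreover from this have "Min V \<le> defect x L (x, \<delta>) ws"
      using \<open>finite V\<close> by (intro Min_le) (auto simp: V_def)
    ultimately show False by linarith
  qed
  then obtain ws where "set ws \<subseteq> X" "defect x L (x, \<delta>) ws \<le> 0" by (auto simp: V_def Y_def)
  then show "reach X x \<delta> L" unfolding defect_le_0_iff reach_def by blast
next
  assume "reach X x \<delta> L"
  then obtain ws where ws: "set ws \<subseteq> X" "defect x L (x, \<delta>) ws \<le> 0"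
    unfolding defect_le_0_iff reach_def by blast
  have "bounded (fst ` set ws)" by (simp add: finite_imp_bounded)
  then obtain B where B: "\<And>z. z \<in> set ws \<Longrightarrow> norm (fst z) \<le> B" by (auto simp: bounded_iff)
  obtain R :: nat where "B < real R" using reals_Archimedean2 by blast
  then have "set ws \<subseteq> X \<inter> ball 0 (real R) \<times> UNIV" using B ws(1) by fastforce
  moreover have "defect x L (x, \<delta>) ws < 1 / real (Suc i)" for i
    using ws(2) by (smt (verit) of_nat_0_less_iff zero_less_Suc zero_less_divide_1_iff)
  ultimately show "X \<in> reach_event x \<delta> L" unfolding reach_event_def by blast
qed

lemma reach_translate:
  fixes X :: "('a::euclidean_space \<times> real) set"
  shows "reach ((\<lambda>z. (fst z + c, snd z)) ` X) (x + c) \<delta> L \<longleftrightarrow> reach X x \<delta> L"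
proof -
  have *: "reach ((\<lambda>z. (fst z + c, snd z)) ` X) (x + c) \<delta> L" if "reach X x \<delta> L" for X :: "('a \<times> real) set" and x c
  proof -
    obtain ws where "set ws \<subseteq> X" "defect x L (x, \<delta>) ws \<le> 0"
      using \<open>reach X x \<delta> L\<close> unfolding defect_le_0_iff reach_def by blast
    moreover have "defect (x + c) L (fst z + c, snd z) (map (\<lambda>z. (fst z + c, snd z)) ws) = defect x L z ws" for z ws
      by (induction ws arbitrary: z) (auto simp: dist_norm)
    from this[of "(x, \<delta>)" ws] have "defect (x + c) L (x + c, \<delta>) (map (\<lambda>z. (fst z + c, snd z)) ws) = defect x L (x, \<delta>) ws"
      by simp
    ultimately show ?thesis unfolding reach_def defect_le_0_iff[symmetric]
      by (intro exI[of _ "map (\<lambda>z. (fst z + c, snd z)) ws"]) auto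
  qed
  show ?thesis
    using *[of X x c] *[of "(\<lambda>z. (fst z + c, snd z)) ` X" "x + c" "- c"] by (auto simp: image_image)
qed

lemma locally_finite_set_translate:
  assumes "locally_finite_set X"
  shows "locally_finite_set ((\<lambda>z. (fst z + c, snd z)) ` X)"
  unfolding locally_finite_set_def
proof
  fix R
  have "{z \<in> (\<lambda>z. (fst z + c, snd z)) ` X. norm (fst z) \<le> R} \<subseteq>
    (\<lambda>z. (fst z + c, snd z)) ` {z\<in>X. norm (fst z) \<le> R + norm c}"
  proof clarify
    fix a b p r assume "norm (fst (fst (p, r) + c, snd (p, r))) \<le> R" "(p, r) \<in> X"
    moreover from this have "norm p \<le> R + norm c"
      using norm_triangle_ineq4[of "p + c" c] by simp
    ultimately show "(fst (p, r) + c, snd (p, r)) \<in> (\<lambda>z. (fst z + c, snd z)) ` {z\<in>X. norm (fst z) \<le> R + norm c}"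
      by force
  qed
  then show "finite {z \<in> (\<lambda>z. (fst z + c, snd z)) ` X. norm (fst z) \<le> R}"
    using assms finite_surj unfolding locally_finite_set_def by blast
qed

text \<open>
  A ball of radius at least \<open>2 * \<delta>\<close> centred in \<open>cball 0 \<delta>\<close> covers \<open>cball 0 \<delta>\<close>, hence contains the
  origin and touches every ball that meets \<open>cball 0 \<delta>\<close>.
\<close>

lemma reach_from_centre:
  assumes "reach X 0 \<delta> L" "0 \<le> \<delta>" "(p, r) \<in> X" "norm p \<le> \<delta>" "2 * \<delta> \<le> r"
  shows "reach X 0 0 L"
proof -
  obtain ws where ws: "set ws \<subseteq> X" "defect 0 L (0, \<delta>) ws \<le> 0"
    using assms(1) unfolding defect_le_0_iff reach_def by blast
  have "defect 0 L (p, r) ws \<le> 0"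
  proof (cases ws)
    case Nil
    then have "L \<le> \<delta>" using ws by simp
    then have "L \<le> norm p + r" using assms norm_ge_zero[of p] by linarith
    then show ?thesis using Nil by simp
  next
    case (Cons w vs)
    have "dist p (fst w) \<le> norm p + norm (fst w)" by (simp add: dist_norm norm_triangle_ineq4)
    then show ?thesis using ws assms Cons by simp
  qed
  then have "defect 0 L (0, 0) ((p, r) # ws) \<le> 0" using assms by simp
  then show ?thesis using ws(1) assms(3) unfolding defect_le_0_iff reach_def
    by (intro exI[of _ "(p, r) # ws"]) auto
qed

section \<open>Avoidance probabilities of the marked Poisson process\<close>

context poisson_point_process
begin

lemma nn_integral_power_count:
  assumes A: "A \<in> sets borel" "bounded A" and s: "0 \<le> s"
  shows "(\<integral>\<^sup>+\<omega>. ennreal (s ^ card (P \<omega> \<inter> A)) \<partial>M) = ennreal (exp (- lam * (1 - s) * measure lborel A))"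
proof -
  define m where "m = lam * measure lborel A"
  have m: "0 \<le> m" using intensity_pos by (simp add: m_def)
  let ?N = "\<lambda>\<omega>. card (P \<omega> \<inter> A)"
  have N[measurable]: "?N \<in> measurable M (count_space UNIV)" using count_measurable[OF A] .
  have "ennreal (s ^ ?N \<omega>) = (\<Sum>k. ennreal (s ^ k) * indicator {\<omega>\<in>space M. ?N \<omega> = k} \<omega>)"
    if "\<omega> \<in> space M" for \<omega>
  proof -
    have "(\<Sum>k. ennreal (s ^ k) * indicator {\<omega>\<in>space M. ?N \<omega> = k} \<omega>) =
      (\<Sum>k\<in>{?N \<omega>}. ennreal (s ^ k) * indicator {\<omega>\<in>space M. ?N \<omega> = k} \<omega>)"
      by (rule suminf_finite) auto
    then show ?thesis using that by simp
  qed
  then have "(\<integral>\<^sup>+\<omega>. ennreal (s ^ ?N \<omega>) \<partial>M) =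
    (\<integral>\<^sup>+\<omega>. (\<Sum>k. ennreal (s ^ k) * indicator {\<omega>\<in>space M. ?N \<omega> = k} \<omega>) \<partial>M)"
    by (intro nn_integral_cong)
  also have "\<dots> = (\<Sum>k. \<integral>\<^sup>+\<omega>. ennreal (s ^ k) * indicator {\<omega>\<in>space M. ?N \<omega> = k} \<omega> \<partial>M)"
    by (rule nn_integral_suminf) measurable
  also have "\<dots> = (\<Sum>k. ennreal (s ^ k) * emeasure M {\<omega>\<in>space M. ?N \<omega> = k})"
    by (intro suminf_cong nn_integral_cmult_indicator) measurable
  also have "\<dots> = (\<Sum>k. ennreal (exp (- m) * ((s * m) ^ k /\<^sub>R fact k)))"
  proof (intro suminf_cong)
    fix k
    have "ennreal (s ^ k) * emeasure M {\<omega>\<in>space M. ?N \<omega> = k} =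
      ennreal (s ^ k) * ennreal (m ^ k / fact k * exp (- m))"
      using count_poisson[OF A, of k] by (simp add: emeasure_eq_measure m_def)
    also have "\<dots> = ennreal (exp (- m) * ((s * m) ^ k /\<^sub>R fact k))"
      using s m by (simp add: ennreal_mult'[symmetric] power_mult_distrib field_simps)
    finally show "ennreal (s ^ k) * emeasure M {\<omega>\<in>space M. ?N \<omega> = k} =
      ennreal (exp (- m) * ((s * m) ^ k /\<^sub>R fact k))" .
  qed
  also have "\<dots> = ennreal (exp (- m) * exp (s * m))"
    using s m by (intro suminf_ennreal_eq sums_mult exp_converges) auto
  also have "exp (- m) * exp (s * m) = exp (- lam * (1 - s) * measure lborel A)"
    by (simp add: exp_add[symmetric] m_def algebra_simps)
  finally show ?thesis .
qed

lemma expectation_prod_power_count: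
  fixes A :: "nat \<Rightarrow> 'a set"
  assumes "finite I" "disjoint_family_on A I" and A: "\<And>i. i \<in> I \<Longrightarrow> A i \<in> sets borel" "\<And>i. i \<in> I \<Longrightarrow> bounded (A i)"
    and s: "\<And>i. 0 \<le> s i"
  shows "expectation (\<lambda>\<omega>. \<Prod>i\<in>I. s i ^ card (P \<omega> \<inter> A i)) =
    exp (- lam * (\<Sum>i\<in>I. (1 - s i) * measure lborel (A i)))"
proof -
  have "indep_vars (\<lambda>_. count_space UNIV) (\<lambda>i \<omega>. card (P \<omega> \<inter> A i)) I"
    by (intro count_indep assms)
  then have ind: "indep_vars (\<lambda>_. borel) (\<lambda>i \<omega>. ennreal (s i ^ card (P \<omega> \<inter> A i))) I"
    by (rule indep_vars_compose2) simp
  have "(\<integral>\<^sup>+\<omega>. ennreal (\<Prod>i\<in>I. s i ^ card (P \<omega> \<inter> A i)) \<partial>M) =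
    (\<integral>\<^sup>+\<omega>. (\<Prod>i\<in>I. ennreal (s i ^ card (P \<omega> \<inter> A i))) \<partial>M)"
    using s by (simp add: prod_ennreal)
  also have "\<dots> = (\<Prod>i\<in>I. \<integral>\<^sup>+\<omega>. ennreal (s i ^ card (P \<omega> \<inter> A i)) \<partial>M)"
    by (intro indep_vars_nn_integral ind \<open>finite I\<close>) auto
  also have "\<dots> = (\<Prod>i\<in>I. ennreal (exp (- lam * (1 - s i) * measure lborel (A i))))"
    using A s by (intro prod.cong nn_integral_power_count) auto
  also have "\<dots> = ennreal (exp (- lam * (\<Sum>i\<in>I. (1 - s i) * measure lborel (A i))))"
    using \<open>finite I\<close> by (simp add: prod_ennreal exp_sum[symmetric] sum_distrib_left mult.assoc sum_negf)
  finally show ?thesis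
    using s by (subst integral_eq_nn_integral)
      (auto intro!: prod_nonneg borel_measurable_prod measurable_compose[OF count_measurable] simp: A)
qed

text \<open>
  The generating functional of the Poisson process: for \<open>g\<close> with finitely many values it is the
  product over the level sets of \<open>g\<close> of the generating functions of independent Poisson variables,
  and the general case follows by rounding \<open>g\<close> down to multiples of \<open>1 / n\<close>. The random variable
  \<open>F\<close> is a measurable version of the product, which need not be measurable itself on the
  null set where the process is not locally finite.
\<close>

lemma expectation_prod_points:
  fixes g :: "'a \<Rightarrow> real"
  assumes g[measurable]: "g \<in> borel_measurable borel" and g01: "\<And>x. 0 \<le> g x" "\<And>x. g x \<le> 1"
    and A[measurable]: "A \<in> sets borel" and bA: "bounded A" and supp: "\<And>x. x \<notin> A \<Longrightarrow> g x = 0"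
    and F[measurable]: "F \<in> borel_measurable M"
    and F_eq: "AE \<omega> in M. F \<omega> = (\<Prod>p\<in>P \<omega> \<inter> A. 1 - g p)"
  shows "expectation F = exp (- lam * (\<integral>x. g x \<partial>lborel))"
proof -
  define gn where "gn n x = real_of_int \<lfloor>g x * real (Suc n)\<rfloor> / real (Suc n)" for n x
  define S where "S n i = {x\<in>A. \<lfloor>g x * real (Suc n)\<rfloor> = int i}" for n i
  define \<Phi> where "\<Phi> n \<omega> = (\<Prod>i\<le>Suc n. (1 - real i / real (Suc n)) ^ card (P \<omega> \<inter> S n i))" for n \<omega>
  have S[measurable]: "S n i \<in> sets borel" for n i unfolding S_def by measurable
  have bS: "bounded (S n i)" for n i using bA by (rule bounded_subset) (auto simp: S_def)
  have disj: "disjoint_family_on (S n) I" for n I by (auto simp: disjoint_family_on_def S_def)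
  have gnS: "gn n x = real i / real (Suc n)" if "x \<in> S n i" for x n i
    using that by (simp add: gn_def S_def)
  have AS: "A = (\<Union>i\<le>Suc n. S n i)" for n
  proof -
    have "\<exists>i\<le>Suc n. \<lfloor>g x * real (Suc n)\<rfloor> = int i" for x
    proof (intro exI conjI)
      have "0 \<le> g x * real (Suc n)" using g01 by simp
      then show "\<lfloor>g x * real (Suc n)\<rfloor> = int (nat \<lfloor>g x * real (Suc n)\<rfloor>)" by simp
      have "g x * real (Suc n) \<le> 1 * real (Suc n)" using g01 by (intro mult_right_mono) auto
      then have "\<lfloor>g x * real (Suc n)\<rfloor> \<le> \<lfloor>real (Suc n)\<rfloor>" by (intro floor_mono) simp
      then have "\<lfloor>g x * real (Suc n)\<rfloor> \<le> int (Suc n)" by (simp only: floor_of_nat)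
      then show "nat \<lfloor>g x * real (Suc n)\<rfloor> \<le> Suc n" by simp
    qed
    then show ?thesis by (auto simp: S_def)
  qed
  have gn_close: "\<bar>gn n x - g x\<bar> \<le> 1 / real (Suc n)" for n x
  proof -
    have "real_of_int \<lfloor>g x * real (Suc n)\<rfloor> \<le> g x * real (Suc n)"
      "g x * real (Suc n) \<le> real_of_int \<lfloor>g x * real (Suc n)\<rfloor> + 1" by linarith+
    then have "\<bar>real_of_int \<lfloor>g x * real (Suc n)\<rfloor> - g x * real (Suc n)\<bar> \<le> 1" by linarith
    moreover have "gn n x - g x = (real_of_int \<lfloor>g x * real (Suc n)\<rfloor> - g x * real (Suc n)) / real (Suc n)"
      by (simp add: gn_def diff_divide_distrib del: of_nat_Suc)
    ultimately show ?thesis by (simp add: abs_divide divide_right_mono del: of_nat_Suc)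
  qed
  have gn_lim: "(\<lambda>n. gn n x) \<longlonglongrightarrow> g x" for x
  proof -
    have "(\<lambda>n. gn n x - g x) \<longlonglongrightarrow> 0"
      by (rule Lim_null_comparison[OF _ LIMSEQ_Suc[OF lim_1_over_n]]) (use gn_close in \<open>simp del: of_nat_Suc\<close>)
    then show ?thesis by (rule LIM_zero_cancel)
  qed
  have gn01: "0 \<le> gn n x" "gn n x \<le> 1" for n x
  proof -
    have "g x * real (Suc n) \<le> 1 * real (Suc n)" using g01 by (intro mult_right_mono) auto
    with of_int_floor_le have "real_of_int \<lfloor>g x * real (Suc n)\<rfloor> \<le> 1 * real (Suc n)"
      by (rule order_trans)
    then show "gn n x \<le> 1" by (simp add: gn_def del: of_nat_Suc)
    show "0 \<le> gn n x" using g01 by (simp add: gn_def)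
  qed
  have E\<Phi>: "expectation (\<Phi> n) = exp (- lam * (\<integral>x. gn n x \<partial>lborel))" for n
  proof -
    have "expectation (\<Phi> n) = exp (- lam * (\<Sum>i\<le>Suc n. (1 - (1 - real i / real (Suc n))) * measure lborel (S n i)))"
    proof -
      have "expectation (\<Phi> n) = expectation (\<lambda>\<omega>. \<Prod>i\<in>{..Suc n}.
          (if i \<le> Suc n then 1 - real i / real (Suc n) else 0) ^ card (P \<omega> \<inter> S n i))"
        unfolding \<Phi>_def by (intro Bochner_Integration.integral_cong prod.cong) auto
      also have "\<dots> = exp (- lam * (\<Sum>i\<in>{..Suc n}.
          (1 - (if i \<le> Suc n then 1 - real i / real (Suc n) else 0)) * measure lborel (S n i)))"
        by (rule expectation_prod_power_count) (auto simp: disj bS)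
      finally show ?thesis by simp
    qed
    also have "(\<Sum>i\<le>Suc n. (1 - (1 - real i / real (Suc n))) * measure lborel (S n i)) =
      (\<Sum>i\<le>Suc n. \<integral>x. real i / real (Suc n) * indicator (S n i) x \<partial>lborel)"
      by simp
    also have "\<dots> = (\<integral>x. (\<Sum>i\<le>Suc n. real i / real (Suc n) * indicator (S n i) x) \<partial>lborel)"
      using emeasure_bounded_finite[OF bS]
      by (intro Bochner_Integration.integral_sum[symmetric] integrable_mult_right integrable_real_indicator) simp_all
    also have "\<dots> = (\<integral>x. gn n x \<partial>lborel)"
    proof (intro Bochner_Integration.integral_cong refl)
      fix x
      show "(\<Sum>i\<le>Suc n. real i / real (Suc n) * indicator (S n i) x) = gn n x"
      proof (cases "x \<in> A")
        case True
        then obtain j where j: "j \<le> Suc n" "x \<in> S n j" using AS[of n] by blast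
        have "(\<Sum>i\<le>Suc n. real i / real (Suc n) * indicator (S n i) x) =
          (\<Sum>i\<in>{j}. real i / real (Suc n) * indicator (S n i) x)"
          using j by (intro sum.mono_neutral_right) (auto simp: S_def)
        then show ?thesis using j gnS[of x n j] by simp
      next
        case False
        then show ?thesis using supp by (simp add: gn_def S_def)
      qed
    qed
    finally show ?thesis .
  qed
  have [measurable]: "\<Phi> n \<in> borel_measurable M" for n
    unfolding \<Phi>_def
    by (intro borel_measurable_prod measurable_compose[OF count_measurable[OF S bS]]) simp
  have \<Phi>_eq: "\<Phi> n \<omega> = (\<Prod>p\<in>P \<omega> \<inter> A. 1 - gn n p)" if "finite (P \<omega> \<inter> A)" for n \<omega>
  proof -
    have "P \<omega> \<inter> A = (\<Union>i\<in>{..Suc n}. P \<omega> \<inter> S n i)" using AS[of n] by blast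
    then have "(\<Prod>p\<in>P \<omega> \<inter> A. 1 - gn n p) = (\<Prod>p\<in>(\<Union>i\<in>{..Suc n}. P \<omega> \<inter> S n i). 1 - gn n p)" by simp
    also have "\<dots> = (\<Prod>i\<le>Suc n. \<Prod>p\<in>P \<omega> \<inter> S n i. 1 - gn n p)"
    proof (rule prod.UNION_disjoint)
      show "\<forall>i\<in>{..Suc n}. finite (P \<omega> \<inter> S n i)"
        using that by (auto simp: S_def intro: finite_subset[rotated])
    qed (auto simp: S_def)
    also have "\<dots> = \<Phi> n \<omega>"
      unfolding \<Phi>_def
    proof (intro prod.cong refl)
      fix i
      have "(\<Prod>p\<in>P \<omega> \<inter> S n i. 1 - gn n p) = (\<Prod>p\<in>P \<omega> \<inter> S n i. 1 - real i / real (Suc n))"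
        by (intro prod.cong) (auto simp: gnS)
      then show "(\<Prod>p\<in>P \<omega> \<inter> S n i. 1 - gn n p) = (1 - real i / real (Suc n)) ^ card (P \<omega> \<inter> S n i)"
        by simp
    qed
    finally show ?thesis ..
  qed
  have "(\<lambda>n. expectation (\<Phi> n)) \<longlonglongrightarrow> expectation F"
  proof (rule integral_dominated_convergence[where w = "\<lambda>_. 1"])
    show "AE \<omega> in M. (\<lambda>n. \<Phi> n \<omega>) \<longlonglongrightarrow> F \<omega>"
      using locally_finite F_eq
    proof eventually_elim
      case (elim \<omega>)
      then have fin: "finite (P \<omega> \<inter> A)" using bA by blast
      have "(\<lambda>n. \<Prod>p\<in>P \<omega> \<inter> A. 1 - gn n p) \<longlonglongrightarrow> (\<Prod>p\<in>P \<omega> \<inter> A. 1 - g p)"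
        by (intro tendsto_intros gn_lim)
      then show ?case using \<Phi>_eq[OF fin] elim by simp
    qed
    show "AE \<omega> in M. norm (\<Phi> n \<omega>) \<le> 1" for n
    proof (rule AE_I2)
      fix \<omega>
      have "0 \<le> (1 - real i / real (Suc n)) ^ card (P \<omega> \<inter> S n i) \<and> (1 - real i / real (Suc n)) ^ card (P \<omega> \<inter> S n i) \<le> 1"
        if "i \<in> {..Suc n}" for i
        using that by (intro conjI zero_le_power power_le_one) (auto simp: field_simps)
      then show "norm (\<Phi> n \<omega>) \<le> 1"
        unfolding \<Phi>_def real_norm_def
        by (subst abs_of_nonneg) (blast intro: prod_nonneg prod_le_1)+
    qed
  qed auto
  moreover have "(\<lambda>n. expectation (\<Phi> n)) \<longlonglongrightarrow> exp (- lam * (\<integral>x. g x \<partial>lborel))"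
    unfolding E\<Phi>
  proof (intro tendsto_intros integral_dominated_convergence[where w = "indicator A"])
    show "gn n \<in> borel_measurable lborel" for n unfolding gn_def by measurable
    show "integrable lborel (indicator A :: 'a \<Rightarrow> real)"
      using emeasure_bounded_finite[OF bA] by (intro integrable_real_indicator) simp_all
    show "AE x in lborel. norm (gn n x) \<le> indicator A x" for n
    proof (rule AE_I2)
      fix x
      show "norm (gn n x) \<le> indicator A x"
        using gn01[of n x] supp[of x] by (cases "x \<in> A") (simp, simp add: gn_def)
    qed
    show "AE x in lborel. (\<lambda>n. gn n x) \<longlonglongrightarrow> g x" using gn_lim by simp
  qed auto
  ultimately show ?thesis by (rule LIMSEQ_unique)
qed

end

abbreviation sequences :: "(nat \<Rightarrow> 'b::topological_space) measure" where
  "sequences \<equiv> (\<Pi>\<^sub>M k\<in>UNIV. borel)"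

context poisson_boolean_model
begin

definition config :: "'w \<Rightarrow> ('a \<times> real) set" where
  "config \<omega> = range (\<lambda>k. (y k \<omega>, \<rho> k \<omega>))"

text \<open>The probability that a point at \<open>x\<close>, together with its random radius, lies in \<open>B\<close>.\<close>

definition mark_prob :: "('a \<times> real) set \<Rightarrow> 'a \<Rightarrow> real" where
  "mark_prob B x = measure \<mu> (Pair x -` B)"

lemma radii_measurable: "\<rho> k \<in> borel_measurable M"
  using radii_indep by (auto simp: indep_vars_def)

lemma prob_space_mu: "prob_space \<mu>"
  using prob_space_distr[OF radii_measurable] radii_law by metis

lemma sets_mu: "sets \<mu> = sets borel"
  using radii_law by (metis sets_distr)

lemma space_mu: "space \<mu> = UNIV"
  using sets_eq_imp_space_eq[OF sets_mu] by simp

lemma sets_borel_pair_mu: "sets ((borel :: 'a measure) \<Otimes>\<^sub>M \<mu>) = sets borel"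
  by (simp add: borel_prod[symmetric] sets_mu cong: sets_pair_measure_cong)

lemma mark_prob_measurable:
  assumes "B \<in> sets borel"
  shows "mark_prob B \<in> borel_measurable borel"
proof -
  interpret \<mu>: prob_space \<mu> by (rule prob_space_mu)
  have "B \<in> sets ((borel :: 'a measure) \<Otimes>\<^sub>M \<mu>)" using assms sets_borel_pair_mu by simp
  from \<mu>.measurable_emeasure_Pair[OF this] show ?thesis
    unfolding mark_prob_def measure_def by measurable
qed

lemma mark_prob_bounds: "0 \<le> mark_prob B x" "mark_prob B x \<le> 1"
  using prob_space.prob_le_1[OF prob_space_mu] by (auto simp: mark_prob_def)

lemma sets_section:
  fixes B :: "('a \<times> real) set"
  assumes "B \<in> sets borel"
  shows "Pair x -` B \<in> sets borel"
  using assms by (intro sets_Pair1[where ?M1.0 = "borel :: 'a measure"]) (unfold borel_prod)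

lemma measurable_points_seq: "(\<lambda>\<omega> k. y k \<omega>) \<in> measurable M sequences"
  using points_measurable by (intro measurable_PiM_single') auto

lemma measurable_radii_seq: "(\<lambda>\<omega> k. \<rho> k \<omega>) \<in> measurable M sequences"
  using radii_measurable by (intro measurable_PiM_single') auto

lemma distr_radii_seq: "distr M sequences (\<lambda>\<omega> k. \<rho> k \<omega>) = (\<Pi>\<^sub>M k\<in>UNIV. \<mu>)"
  using radii_indep radii_measurable
  by (subst (asm) indep_vars_iff_distr_eq_PiM) (auto simp: radii_law restrict_def)

lemma distr_points_radii:
  "distr M (sequences \<Otimes>\<^sub>M sequences) (\<lambda>\<omega>. (\<lambda>k. y k \<omega>, \<lambda>k. \<rho> k \<omega>)) =
    distr M sequences (\<lambda>\<omega> k. y k \<omega>) \<Otimes>\<^sub>M (\<Pi>\<^sub>M k\<in>UNIV. \<mu>)"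
proof (rule sym, rule pair_measure_eqI)
  note [measurable] = measurable_points_seq measurable_radii_seq
  interpret Y: prob_space "distr M sequences (\<lambda>\<omega> k. y k \<omega>)" by (rule prob_space_distr) measurable
  interpret R: prob_space "distr M sequences (\<lambda>\<omega> k. \<rho> k \<omega>)" by (rule prob_space_distr) measurable
  show "sigma_finite_measure (distr M sequences (\<lambda>\<omega> k. y k \<omega>))" ..
  show "sigma_finite_measure (\<Pi>\<^sub>M k\<in>(UNIV::nat set). \<mu>)"
    unfolding distr_radii_seq[symmetric] ..
  show "sets (distr M sequences (\<lambda>\<omega> k. y k \<omega>) \<Otimes>\<^sub>M (\<Pi>\<^sub>M k\<in>(UNIV::nat set). \<mu>)) =
    sets (distr M (sequences \<Otimes>\<^sub>M sequences) (\<lambda>\<omega>. (\<lambda>k. y k \<omega>, \<lambda>k. \<rho> k \<omega>)))"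
    unfolding distr_radii_seq[symmetric] by (simp cong: sets_pair_measure_cong)
  fix A :: "(nat \<Rightarrow> 'a) set" and C :: "(nat \<Rightarrow> real) set"
  assume "A \<in> sets (distr M sequences (\<lambda>\<omega> k. y k \<omega>))" "C \<in> sets (\<Pi>\<^sub>M k\<in>(UNIV::nat set). \<mu>)"
  then have A[measurable]: "A \<in> sets sequences" and C[measurable]: "C \<in> sets sequences"
    by (simp_all add: distr_radii_seq[symmetric])
  have "prob ((\<lambda>\<omega> k. y k \<omega>) -` A \<inter> space M \<inter> ((\<lambda>\<omega> k. \<rho> k \<omega>) -` C \<inter> space M)) =
    prob ((\<lambda>\<omega> k. y k \<omega>) -` A \<inter> space M) * prob ((\<lambda>\<omega> k. \<rho> k \<omega>) -` C \<inter> space M)"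
    by (intro indep_setD[OF radii_indep_points] in_vimage_algebra A C)
  moreover have "(\<lambda>\<omega>. (\<lambda>k. y k \<omega>, \<lambda>k. \<rho> k \<omega>)) -` (A \<times> C) \<inter> space M =
    (\<lambda>\<omega> k. y k \<omega>) -` A \<inter> space M \<inter> ((\<lambda>\<omega> k. \<rho> k \<omega>) -` C \<inter> space M)" by auto
  ultimately show "emeasure (distr M sequences (\<lambda>\<omega> k. y k \<omega>)) A * emeasure (\<Pi>\<^sub>M k\<in>(UNIV::nat set). \<mu>) C =
    emeasure (distr M (sequences \<Otimes>\<^sub>M sequences) (\<lambda>\<omega>. (\<lambda>k. y k \<omega>, \<lambda>k. \<rho> k \<omega>))) (A \<times> C)"
    unfolding distr_radii_seq[symmetric]
    by (simp add: emeasure_distr emeasure_eq_measure ennreal_mult)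
qed

text \<open>
  Given the points, the radii are independent with law \<open>\<mu>\<close>, so that the point \<open>y k\<close> with its radius
  avoids \<open>B\<close> with conditional probability \<open>1 - mark_prob B (y k)\<close>, independently for each \<open>k\<close>.
\<close>

lemma prob_first_points_avoid:
  assumes B: "B \<in> sets borel"
  shows "prob {\<omega>\<in>space M. \<forall>k<n. (y k \<omega>, \<rho> k \<omega>) \<notin> B} = expectation (\<lambda>\<omega>. \<Prod>k<n. 1 - mark_prob B (y k \<omega>))"
proof -
  note [measurable] = measurable_points_seq measurable_radii_seq mark_prob_measurable[OF B] points_measurable
  interpret \<mu>: prob_space \<mu> by (rule prob_space_mu)
  interpret PM: product_prob_space "\<lambda>_::nat. \<mu>" UNIV ..
  interpret PM: sigma_finite_measure "\<Pi>\<^sub>M k\<in>(UNIV::nat set). \<mu>"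
    by (intro prob_space_imp_sigma_finite prob_space_PiM prob_space_mu)
  define E :: "((nat \<Rightarrow> 'a) \<times> (nat \<Rightarrow> real)) set" where "E = {(a, r). \<forall>k<n. (a k, r k) \<notin> B}"
  have E[measurable]: "E \<in> sets (sequences \<Otimes>\<^sub>M sequences)"
  proof -
    have 1: "(\<lambda>w. (fst w k, snd w k)) \<in> measurable (sequences \<Otimes>\<^sub>M sequences) ((borel :: 'a measure) \<Otimes>\<^sub>M (borel :: real measure))" for k
      by measurable
    have "{w \<in> space (sequences \<Otimes>\<^sub>M sequences). (fst w k, snd w k) \<in> - B} \<in> sets ((sequences :: (nat \<Rightarrow> 'a) measure) \<Otimes>\<^sub>M (sequences :: (nat \<Rightarrow> real) measure))" for k
      using measurable_sets[OF 1, of "- B" k, unfolded borel_prod, OF borel_comp[OF B]]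
      by (simp add: vimage_def Int_def conj_commute)
    then have "{w \<in> space (sequences \<Otimes>\<^sub>M sequences). \<forall>k\<in>{..<n}. (fst w k, snd w k) \<in> - B} \<in> sets ((sequences :: (nat \<Rightarrow> 'a) measure) \<Otimes>\<^sub>M (sequences :: (nat \<Rightarrow> real) measure))"
      by (intro sets.sets_Collect_finite_All) auto
    moreover have "E = {w \<in> space (sequences \<Otimes>\<^sub>M sequences). \<forall>k\<in>{..<n}. (fst w k, snd w k) \<in> - B}"
      by (auto simp: E_def space_pair_measure space_PiM)
    ultimately show ?thesis by simp
  qed
  have E': "E \<in> sets (distr M sequences (\<lambda>\<omega> k. y k \<omega>) \<Otimes>\<^sub>M (\<Pi>\<^sub>M k\<in>(UNIV::nat set). \<mu>))"
    using E by (simp add: distr_radii_seq[symmetric] cong: sets_pair_measure_cong)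
  have sec: "emeasure (\<Pi>\<^sub>M k\<in>(UNIV::nat set). \<mu>) (Pair a -` E) = ennreal (\<Prod>k<n. 1 - mark_prob B (a k))" for a
  proof -
    have "Pair a -` E = {r\<in>space (\<Pi>\<^sub>M k\<in>(UNIV::nat set). \<mu>). \<forall>k\<in>{..<n}. r k \<in> - (Pair (a k) -` B)}"
      by (auto simp: E_def space_PiM space_mu)
    then have "emeasure (\<Pi>\<^sub>M k\<in>(UNIV::nat set). \<mu>) (Pair a -` E) = (\<Prod>k<n. emeasure \<mu> (- (Pair (a k) -` B)))"
      using sets_section[OF B] by (subst (1) \<open>Pair a -` E = _\<close>, subst PM.emeasure_PiM_Collect) (simp_all add: sets_mu borel_comp)
    also have "\<dots> = (\<Prod>k<n. ennreal (1 - mark_prob B (a k)))"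
    proof (rule prod.cong[OF refl])
      fix k
      have "\<mu>.prob (space \<mu> - Pair (a k) -` B) = 1 - mark_prob B (a k)"
        unfolding mark_prob_def using sets_section[OF B] by (intro \<mu>.prob_compl) (simp add: sets_mu)
      then show "emeasure \<mu> (- (Pair (a k) -` B)) = ennreal (1 - mark_prob B (a k))"
        by (simp add: \<mu>.emeasure_eq_measure space_mu Compl_eq_Diff_UNIV)
    qed
    also have "\<dots> = ennreal (\<Prod>k<n. 1 - mark_prob B (a k))"
      using mark_prob_bounds by (intro prod_ennreal) auto
    finally show ?thesis .
  qed
  have "emeasure M {\<omega>\<in>space M. \<forall>k<n. (y k \<omega>, \<rho> k \<omega>) \<notin> B} =
    emeasure (distr M (sequences \<Otimes>\<^sub>M sequences) (\<lambda>\<omega>. (\<lambda>k. y k \<omega>, \<lambda>k. \<rho> k \<omega>))) E"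
  proof (subst emeasure_distr[OF _ E])
    have "(\<lambda>\<omega>. (\<lambda>k. y k \<omega>, \<lambda>k. \<rho> k \<omega>)) -` E \<inter> space M = {\<omega>\<in>space M. \<forall>k<n. (y k \<omega>, \<rho> k \<omega>) \<notin> B}"
      by (auto simp: E_def)
    then show "emeasure M {\<omega>\<in>space M. \<forall>k<n. (y k \<omega>, \<rho> k \<omega>) \<notin> B} =
      emeasure M ((\<lambda>\<omega>. (\<lambda>k. y k \<omega>, \<lambda>k. \<rho> k \<omega>)) -` E \<inter> space M)" by simp
  qed measurable
  also have "\<dots> = (\<integral>\<^sup>+a. ennreal (\<Prod>k<n. 1 - mark_prob B (a k)) \<partial>distr M sequences (\<lambda>\<omega> k. y k \<omega>))"
    unfolding distr_points_radii by (subst PM.emeasure_pair_measure_alt[OF E']) (simp only: sec)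
  also have "\<dots> = (\<integral>\<^sup>+\<omega>. ennreal (\<Prod>k<n. 1 - mark_prob B (y k \<omega>)) \<partial>M)"
    by (subst nn_integral_distr) auto
  also have "\<dots> = ennreal (expectation (\<lambda>\<omega>. \<Prod>k<n. 1 - mark_prob B (y k \<omega>)))"
  proof (rule nn_integral_eq_integral)
    show "integrable M (\<lambda>\<omega>. \<Prod>k<n. 1 - mark_prob B (y k \<omega>))"
      using mark_prob_bounds
      by (intro integrable_const_bound[where B = 1])
        (auto simp: abs_prod intro!: prod_le_1 AE_I2)
  qed (use mark_prob_bounds in \<open>auto intro!: prod_nonneg\<close>)
  finally show ?thesis
    using mark_prob_bounds
    by (simp add: emeasure_eq_measure integral_nonneg_AE prod_nonneg)
qed

text \<open>
  Averaging over the points turns the product of the conditional probabilities into the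
  generating functional of the Poisson process at \<open>mark_prob B\<close>. This is the void probability of a
  Poisson process on pairs with intensity measure \<open>lam\<close> times Lebesgue measure times \<open>\<mu>\<close>.
\<close>

lemma prob_config_avoid:
  assumes B: "B \<in> regions"
  shows "prob {\<omega>\<in>space M. config \<omega> \<inter> B = {}} = exp (- lam * (\<integral>x. mark_prob B x \<partial>lborel))"
proof -
  have Bs: "B \<in> sets borel" using B by (simp add: regions_def)
  note [measurable] = mark_prob_measurable[OF Bs] points_measurable radii_measurable
  obtain R where R: "fst ` B \<subseteq> cball 0 R"
    using B bounded_subset_ballD[of "fst ` B" 0] ball_subset_cball by (fastforce simp: regions_def)
  define A where "A = (cball 0 R :: 'a set)"
  have supp: "mark_prob B x = 0" if "x \<notin> A" for x
  proof -
    have "Pair x -` B = {}" using that R by (force simp: A_def)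
    then show ?thesis by (simp add: mark_prob_def)
  qed
  \<comment> \<open>The product over \<open>k < n\<close> is eventually constant in \<open>n\<close>, as only points in \<open>A\<close> contribute.\<close>
  define \<Psi> where "\<Psi> n \<omega> = (\<Prod>k<n. 1 - mark_prob B (y k \<omega>))" for n \<omega>
  define F where "F \<omega> = lim (\<lambda>n. \<Psi> n \<omega>)" for \<omega>
  have \<Psi>01: "0 \<le> \<Psi> n \<omega>" "\<Psi> n \<omega> \<le> 1" for n \<omega>
    unfolding \<Psi>_def using mark_prob_bounds by (auto intro!: prod_nonneg prod_le_1)
  have [measurable]: "\<Psi> n \<in> borel_measurable M" for n unfolding \<Psi>_def by measurable
  have F[measurable]: "F \<in> borel_measurable M" unfolding F_def by measurable
  have lim: "(\<lambda>n. \<Psi> n \<omega>) \<longlonglongrightarrow> F \<omega> \<and> F \<omega> = (\<Prod>p\<in>range (\<lambda>k. y k \<omega>) \<inter> A. 1 - mark_prob B p)"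
    if inj: "inj (\<lambda>k. y k \<omega>)" and fin: "\<forall>A. bounded A \<longrightarrow> finite (range (\<lambda>k. y k \<omega>) \<inter> A)" for \<omega>
  proof -
    define K where "K = {k. y k \<omega> \<in> A}"
    have "bounded A" by (simp add: A_def)
    then have "finite (range (\<lambda>k. y k \<omega>) \<inter> A)" using fin by blast
    moreover have im: "(\<lambda>k. y k \<omega>) ` K = range (\<lambda>k. y k \<omega>) \<inter> A" by (auto simp: K_def)
    ultimately have "finite K" using inj by (metis finite_imageD inj_on_subset subset_UNIV)
    then obtain m where m: "\<And>k. k \<in> K \<Longrightarrow> k < m" using finite_nat_set_iff_bounded by auto
    have "\<Psi> n \<omega> = (\<Prod>p\<in>range (\<lambda>k. y k \<omega>) \<inter> A. 1 - mark_prob B p)" if "m \<le> n" for n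
    proof -
      have "\<Psi> n \<omega> = (\<Prod>k\<in>K. 1 - mark_prob B (y k \<omega>))"
        unfolding \<Psi>_def using m that by (intro prod.mono_neutral_right) (auto simp: K_def supp intro: less_le_trans)
      also have "\<dots> = (\<Prod>p\<in>(\<lambda>k. y k \<omega>) ` K. 1 - mark_prob B p)"
        using inj by (subst prod.reindex) (auto intro: inj_on_subset)
      finally show ?thesis by (simp add: im)
    qed
    then have *: "(\<lambda>n. \<Psi> n \<omega>) \<longlonglongrightarrow> (\<Prod>p\<in>range (\<lambda>k. y k \<omega>) \<inter> A. 1 - mark_prob B p)"
      by (intro tendsto_eventually eventually_sequentiallyI[of m]) auto
    then show ?thesis unfolding F_def by (simp add: limI)
  qed
  have "AE \<omega> in M. (\<lambda>n. \<Psi> n \<omega>) \<longlonglongrightarrow> F \<omega> \<and> F \<omega> = (\<Prod>p\<in>range (\<lambda>k. y k \<omega>) \<inter> A. 1 - mark_prob B p)"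
    using points_distinct locally_finite by eventually_elim (rule lim)
  then have AE_lim: "AE \<omega> in M. (\<lambda>n. \<Psi> n \<omega>) \<longlonglongrightarrow> F \<omega>"
    and AE_F: "AE \<omega> in M. F \<omega> = (\<Prod>p\<in>range (\<lambda>k. y k \<omega>) \<inter> A. 1 - mark_prob B p)" by auto
  have "(\<lambda>n. expectation (\<Psi> n)) \<longlonglongrightarrow> expectation F"
    by (rule integral_dominated_convergence[where w = "\<lambda>_. 1"]) (use AE_lim \<Psi>01 in auto)
  also have "expectation F = exp (- lam * (\<integral>x. mark_prob B x \<partial>lborel))"
    by (rule expectation_prod_points[OF _ mark_prob_bounds _ _ supp _ AE_F]) (auto simp: A_def)
  also have "(\<lambda>n. expectation (\<Psi> n)) = (\<lambda>n. prob {\<omega>\<in>space M. \<forall>k<n. (y k \<omega>, \<rho> k \<omega>) \<notin> B})"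
    unfolding \<Psi>_def prob_first_points_avoid[OF Bs] ..
  finally have 1: "(\<lambda>n. prob {\<omega>\<in>space M. \<forall>k<n. (y k \<omega>, \<rho> k \<omega>) \<notin> B}) \<longlonglongrightarrow>
    exp (- lam * (\<integral>x. mark_prob B x \<partial>lborel))" .
  have "(\<lambda>\<omega>. (y k \<omega>, \<rho> k \<omega>)) \<in> measurable M borel" for k
    unfolding borel_prod[symmetric] by measurable
  from measurable_sets[OF this, of "- B"] have hit: "{\<omega>\<in>space M. (y k \<omega>, \<rho> k \<omega>) \<notin> B} \<in> events" for k
    using borel_comp[OF Bs] by (simp add: vimage_def Int_def conj_commute)
  have ev: "{\<omega>\<in>space M. \<forall>k<n. (y k \<omega>, \<rho> k \<omega>) \<notin> B} \<in> events" for n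
  proof -
    have "{\<omega>\<in>space M. \<forall>k\<in>{..<n}. (y k \<omega>, \<rho> k \<omega>) \<notin> B} \<in> events"
      by (intro sets.sets_Collect_finite_All hit) auto
    then show ?thesis by (simp only: Ball_def lessThan_iff)
  qed
  have "(\<lambda>n. prob {\<omega>\<in>space M. \<forall>k<n. (y k \<omega>, \<rho> k \<omega>) \<notin> B}) \<longlonglongrightarrow>
    prob (\<Inter>n. {\<omega>\<in>space M. \<forall>k<n. (y k \<omega>, \<rho> k \<omega>) \<notin> B})"
  proof (rule finite_Lim_measure_decseq)
    show "range (\<lambda>n. {\<omega>\<in>space M. \<forall>k<n. (y k \<omega>, \<rho> k \<omega>) \<notin> B}) \<subseteq> events" using ev by blast
    show "decseq (\<lambda>n. {\<omega>\<in>space M. \<forall>k<n. (y k \<omega>, \<rho> k \<omega>) \<notin> B})"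
      unfolding decseq_def using less_le_trans by blast
  qed
  also have "(\<Inter>n. {\<omega>\<in>space M. \<forall>k<n. (y k \<omega>, \<rho> k \<omega>) \<notin> B}) = {\<omega>\<in>space M. config \<omega> \<inter> B = {}}"
  proof (intro equalityI subsetI)
    fix \<omega> assume "\<omega> \<in> (\<Inter>n. {\<omega>\<in>space M. \<forall>k<n. (y k \<omega>, \<rho> k \<omega>) \<notin> B})"
    then have "\<omega> \<in> space M" "(y k \<omega>, \<rho> k \<omega>) \<notin> B" for k by blast+
    then show "\<omega> \<in> {\<omega>\<in>space M. config \<omega> \<inter> B = {}}" unfolding config_def by blast
  qed (auto simp: config_def)
  finally show ?thesis using 1 LIMSEQ_unique by blast
qed

lemma measurable_config [measurable]: "config \<in> measurable M configurations"
proof (rule measurable_configurations)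
  fix B :: "('a \<times> real) set" assume B: "B \<in> regions"
  note [measurable] = points_measurable radii_measurable
  have "(\<lambda>\<omega>. (y k \<omega>, \<rho> k \<omega>)) \<in> measurable M borel" for k
    unfolding borel_prod[symmetric] by measurable
  from measurable_sets[OF this, of "- B"] have "{\<omega>\<in>space M. (y k \<omega>, \<rho> k \<omega>) \<notin> B} \<in> events" for k
    using B borel_comp[of B] by (simp add: regions_def vimage_def Int_def conj_commute)
  then have "{\<omega>\<in>space M. \<forall>k. (y k \<omega>, \<rho> k \<omega>) \<notin> B} \<in> events"
    by (rule sets.sets_Collect_countable_All)
  also have "{\<omega>\<in>space M. \<forall>k. (y k \<omega>, \<rho> k \<omega>) \<notin> B} = {\<omega>\<in>space M. config \<omega> \<inter> B = {}}"
    by (auto simp: config_def)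
  finally show "{\<omega>\<in>space M. config \<omega> \<inter> B = {}} \<in> events" .
qed

end

section \<open>Invariance, independence and percolation\<close>

context poisson_boolean_model
begin

definition intensity :: "('a \<times> real) set \<Rightarrow> real" where
  "intensity B = lam * (\<integral>x. mark_prob B x \<partial>lborel)"

lemma emeasure_config_avoid:
  "B \<in> regions \<Longrightarrow> emeasure M {\<omega>\<in>space M. config \<omega> \<inter> B = {}} = ennreal (exp (- intensity B))"
  using prob_config_avoid[of B] by (simp add: emeasure_eq_measure intensity_def)

lemma integrable_mark_prob:
  assumes B: "B \<in> regions"
  shows "integrable lborel (mark_prob B)"
proof -
  obtain R where R: "fst ` B \<subseteq> cball 0 R"
    using B bounded_subset_ballD[of "fst ` B" 0] ball_subset_cball by (fastforce simp: regions_def)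
  have "mark_prob B x \<le> indicator (cball 0 R) x" for x
  proof (cases "x \<in> cball 0 R")
    case False
    then have "Pair x -` B = {}" using R by force
    then show ?thesis by (simp add: mark_prob_def)
  qed (simp add: mark_prob_bounds)
  moreover have "integrable lborel (indicator (cball 0 R) :: 'a \<Rightarrow> real)"
    using emeasure_bounded_finite[of "cball (0::'a) R"] by (intro integrable_real_indicator) simp_all
  moreover have "mark_prob B \<in> borel_measurable lborel"
    using mark_prob_measurable[of B] B by (simp add: regions_def)
  ultimately show ?thesis
    using mark_prob_bounds by (intro Bochner_Integration.integrable_bound[of lborel "indicator (cball 0 R)" "mark_prob B"]) auto
qed

lemma intensity_Un:
  assumes A: "A \<in> regions" and B: "B \<in> regions" and "A \<inter> B = {}"
  shows "intensity (A \<union> B) = intensity A + intensity B"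
proof -
  interpret \<mu>: prob_space \<mu> by (rule prob_space_mu)
  have "mark_prob (A \<union> B) x = mark_prob A x + mark_prob B x" for x
    unfolding mark_prob_def vimage_Un using assms sets_section[of A x] sets_section[of B x]
    by (intro \<mu>.finite_measure_Union) (auto simp: sets_mu regions_def)
  then show ?thesis
    using integrable_mark_prob[OF A] integrable_mark_prob[OF B] by (simp add: intensity_def distrib_left)
qed

lemma intensity_translate:
  assumes B: "B \<in> regions"
  shows "intensity ((\<lambda>z. (fst z + c, snd z)) -` B) = intensity B"
proof -
  have [measurable]: "mark_prob B \<in> borel_measurable borel"
    using mark_prob_measurable[of B] B by (simp add: regions_def)
  have "mark_prob ((\<lambda>z. (fst z + c, snd z)) -` B) x = mark_prob B (c + x)" for x
    by (simp add: mark_prob_def vimage_def add.commute)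
  moreover have "(\<integral>x. mark_prob B (c + x) \<partial>lborel) = (\<integral>x. mark_prob B x \<partial>distr lborel borel ((+) c))"
    by (subst integral_distr) auto
  ultimately show ?thesis by (simp add: intensity_def lborel_distr_plus)
qed

lemma distr_config_translate:
  "distr M configurations (\<lambda>\<omega>. (\<lambda>z. (fst z + c, snd z)) ` config \<omega>) = distr M configurations config"
proof (rule configurations_measure_eqI)
  note [measurable] = measurable_compose[OF measurable_config measurable_translate_configurations[of c]]
  show "finite_measure (distr M configurations (\<lambda>\<omega>. (\<lambda>z. (fst z + c, snd z)) ` config \<omega>))"
    by (rule finite_measure_distr) measurable
  fix B :: "('a \<times> real) set" assume B: "B \<in> regions"
  have av: "avoid B \<in> sets configurations" using B by (intro sets_avoid) (simp add: regions_def)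
  have "emeasure (distr M configurations (\<lambda>\<omega>. (\<lambda>z. (fst z + c, snd z)) ` config \<omega>)) (avoid B) =
    emeasure M {\<omega>\<in>space M. config \<omega> \<inter> ((\<lambda>z. (fst z + c, snd z)) -` B) = {}}"
    by (subst emeasure_distr[OF _ av]) (auto simp: avoid_def intro!: arg_cong[where f = "emeasure M"])
  also have "\<dots> = emeasure M {\<omega>\<in>space M. config \<omega> \<inter> B = {}}"
    using B translate_regions[OF B] by (simp add: emeasure_config_avoid intensity_translate)
  also have "\<dots> = emeasure (distr M configurations config) (avoid B)"
    by (subst emeasure_distr[OF _ av]) (auto simp: avoid_def intro!: arg_cong[where f = "emeasure M"])
  finally show "emeasure (distr M configurations (\<lambda>\<omega>. (\<lambda>z. (fst z + c, snd z)) ` config \<omega>)) (avoid B) =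
    emeasure (distr M configurations config) (avoid B)" .
qed simp_all

lemma AE_locally_finite_config: "AE \<omega> in M. locally_finite_set (config \<omega>)"
  using points_distinct locally_finite
proof eventually_elim
  case (elim \<omega>)
  show ?case unfolding locally_finite_set_def
  proof
    fix R
    have "finite (range (\<lambda>k. y k \<omega>) \<inter> cball 0 R)" using elim(2) bounded_cball by blast
    moreover have "(\<lambda>k. y k \<omega>) ` {k. norm (y k \<omega>) \<le> R} = range (\<lambda>k. y k \<omega>) \<inter> cball 0 R" by auto
    ultimately have "finite {k. norm (y k \<omega>) \<le> R}"
      using elim(1) by (metis finite_imageD inj_on_subset subset_UNIV)
    moreover have "{z\<in>config \<omega>. norm (fst z) \<le> R} = (\<lambda>k. (y k \<omega>, \<rho> k \<omega>)) ` {k. norm (y k \<omega>) \<le> R}"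
      by (auto simp: config_def)
    ultimately show "finite {z\<in>config \<omega>. norm (fst z) \<le> R}" by simp
  qed
qed

definition reach_prob :: "'a \<Rightarrow> real \<Rightarrow> real \<Rightarrow> real" where
  "reach_prob x \<delta> L = prob {\<omega>\<in>space M. config \<omega> \<in> reach_event x \<delta> L}"

lemma events_config: "F \<in> sets configurations \<Longrightarrow> {\<omega>\<in>space M. config \<omega> \<in> F} \<in> events"
  using measurable_sets[OF measurable_config, of F] by (simp add: vimage_def Int_def conj_commute)

lemma reach_prob_translate: "reach_prob x \<delta> L = reach_prob 0 \<delta> L"
proof -
  let ?T = "\<lambda>X. (\<lambda>z. (fst z + x, snd z)) ` X"
  note T = measurable_compose[OF measurable_config measurable_translate_configurations[of x]]
  have ev: "{\<omega>\<in>space M. ?T (config \<omega>) \<in> reach_event x \<delta> L} \<in> events"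
    using measurable_sets[OF T sets_reach_event] by (simp add: vimage_def Int_def conj_commute)
  have "reach_prob x \<delta> L = measure (distr M configurations config) (reach_event x \<delta> L)"
    unfolding reach_prob_def by (subst measure_distr) (auto intro!: arg_cong[where f = prob])
  also have "\<dots> = measure (distr M configurations (\<lambda>\<omega>. ?T (config \<omega>))) (reach_event x \<delta> L)"
    by (simp only: distr_config_translate)
  also have "\<dots> = prob {\<omega>\<in>space M. ?T (config \<omega>) \<in> reach_event x \<delta> L}"
    by (subst measure_distr[OF T]) (auto intro!: arg_cong[where f = prob])
  also have "\<dots> = prob {\<omega>\<in>space M. config \<omega> \<in> reach_event 0 \<delta> L}"
  proof (rule finite_measure_eq_AE)
    show "AE \<omega> in M. (\<omega> \<in> {\<omega>\<in>space M. ?T (config \<omega>) \<in> reach_event x \<delta> L}) =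
      (\<omega> \<in> {\<omega>\<in>space M. config \<omega> \<in> reach_event 0 \<delta> L})"
      using AE_locally_finite_config
    proof eventually_elim
      case (elim \<omega>)
      then show ?case
        using reach_translate[of x "config \<omega>" 0] by (simp add: reach_event_iff locally_finite_set_translate)
    qed
  qed (use ev events_config in auto)
  finally show ?thesis by (simp add: reach_prob_def)
qed

text \<open>
  As functions of \<open>F\<close> both sides are finite measures on configurations. On the generator \<open>avoid B\<close>
  they agree because \<open>T\<close> and \<open>B - T\<close> are disjoint and \<open>intensity\<close> is additive.
\<close>

lemma prob_avoid_and_rest:
  assumes T: "T \<in> regions" and F: "F \<in> sets configurations"
  shows "prob {\<omega>\<in>space M. config \<omega> \<inter> T = {} \<and> config \<omega> - T \<in> F} =
    prob {\<omega>\<in>space M. config \<omega> \<inter> T = {}} * prob {\<omega>\<in>space M. config \<omega> - T \<in> F}"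
proof -
  have Ts: "T \<in> sets borel" using T by (simp add: regions_def)
  define E where "E = {\<omega>\<in>space M. config \<omega> \<inter> T = {}}"
  note D[measurable] = measurable_compose[OF measurable_config measurable_Diff_configurations[OF Ts]]
  have E[measurable]: "E \<in> events"
    using events_config[OF sets_avoid[OF Ts]] by (simp add: E_def avoid_def)
  define \<nu>1 where "\<nu>1 = distr (density M (indicator E)) configurations (\<lambda>\<omega>. config \<omega> - T)"
  define \<nu>2 where "\<nu>2 = scale_measure (ennreal (prob E)) (distr M configurations (\<lambda>\<omega>. config \<omega> - T))"
  have pre: "{\<omega>\<in>space M. config \<omega> - T \<in> G} \<in> events" if "G \<in> sets configurations" for G
    using measurable_sets[OF D that] by (simp add: vimage_def Int_def conj_commute)
  have n1: "emeasure \<nu>1 G = emeasure M (E \<inter> {\<omega>\<in>space M. config \<omega> - T \<in> G})" if G: "G \<in> sets configurations" for G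
  proof -
    have "emeasure \<nu>1 G = emeasure (density M (indicator E)) {\<omega>\<in>space M. config \<omega> - T \<in> G}"
      unfolding \<nu>1_def by (subst emeasure_distr[OF _ G]) (auto intro!: arg_cong2[where f = emeasure])
    also have "\<dots> = emeasure M (E \<inter> {\<omega>\<in>space M. config \<omega> - T \<in> G})"
      using pre[OF G] E by (subst emeasure_density) (auto simp: indicator_inter_arith[symmetric])
    finally show ?thesis .
  qed
  have n2: "emeasure \<nu>2 G = emeasure M E * emeasure M {\<omega>\<in>space M. config \<omega> - T \<in> G}" if G: "G \<in> sets configurations" for G
    unfolding \<nu>2_def using G
    by (subst emeasure_scale_measure, subst emeasure_distr[OF _ G])
      (auto simp: emeasure_eq_measure intro!: arg_cong2[where f = "(*)"] arg_cong[where f = "\<lambda>A. ennreal (prob A)"])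
  have "\<nu>1 = \<nu>2"
  proof (rule configurations_measure_eqI)
    show "finite_measure \<nu>1"
      using n1[of UNIV] sets.top[of "configurations :: ('a \<times> real) set measure"]
      by (intro finite_measureI) (simp add: \<nu>1_def[symmetric], simp add: \<nu>1_def)
    show "sets \<nu>1 = sets configurations" "sets \<nu>2 = sets configurations"
      by (simp_all add: \<nu>1_def \<nu>2_def)
    fix B :: "('a \<times> real) set" assume B: "B \<in> regions"
    have av: "avoid B \<in> sets configurations" using B by (intro sets_avoid) (simp add: regions_def)
    have BT: "B - T \<in> regions" by (rule regions_Diff[OF B Ts])
    have 1: "E \<inter> {\<omega>\<in>space M. config \<omega> - T \<in> avoid B} = {\<omega>\<in>space M. config \<omega> \<inter> (T \<union> (B - T)) = {}}"
      by (auto simp: E_def avoid_def)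
    have 2: "{\<omega>\<in>space M. config \<omega> - T \<in> avoid B} = {\<omega>\<in>space M. config \<omega> \<inter> (B - T) = {}}"
      by (auto simp: avoid_def)
    show "emeasure \<nu>1 (avoid B) = emeasure \<nu>2 (avoid B)"
      unfolding n1[OF av] n2[OF av] 1
      unfolding 2 E_def emeasure_config_avoid[OF T] emeasure_config_avoid[OF BT]
        emeasure_config_avoid[OF regions_Un[OF T BT]]
      using intensity_Un[OF T BT] by (simp add: ennreal_mult[symmetric] exp_add[symmetric])
  qed
  then have "emeasure M (E \<inter> {\<omega>\<in>space M. config \<omega> - T \<in> F}) = emeasure M E * emeasure M {\<omega>\<in>space M. config \<omega> - T \<in> F}"
    using n1[OF F] n2[OF F] by simp
  moreover have "E \<inter> {\<omega>\<in>space M. config \<omega> - T \<in> F} = {\<omega>\<in>space M. config \<omega> \<inter> T = {} \<and> config \<omega> - T \<in> F}"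
    by (auto simp: E_def)
  ultimately show ?thesis by (simp add: emeasure_eq_measure E_def ennreal_mult[symmetric])
qed

text \<open>
  Let \<open>T\<close> consist of the balls to which \<open>reach_from_centre\<close> applies, and \<open>p < 1\<close> be the probability
  that there is none. Where there is one, a chain from \<open>cball 0 \<delta>\<close> gives a chain from the origin,
  so only the event that there is none has to be bounded. There only balls outside of \<open>T\<close> matter, and
  since these are independent of the balls in \<open>T\<close>, their reach has the same
  probability as it has where there is a ball in \<open>T\<close>.
\<close>

lemma reach_prob_sprinkle:
  assumes \<delta>: "0 < \<delta>" and big: "0 < measure \<mu> {2 * \<delta>..}"
  obtains h where "0 < h" "\<And>L. h * reach_prob 0 \<delta> L \<le> reach_prob 0 0 L"
proof -
  define T where "T = cball (0::'a) \<delta> \<times> {2 * \<delta>..}"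
  have "T \<in> sets (borel \<Otimes>\<^sub>M borel)" unfolding T_def by measurable
  then have Ts: "T \<in> sets borel" by (simp only: borel_prod)
  have "fst ` T \<subseteq> cball 0 \<delta>" by (auto simp: T_def)
  then have "bounded (fst ` T)" by (rule bounded_subset[OF bounded_cball])
  then have T: "T \<in> regions" using Ts by (simp add: regions_def)
  define p where "p = prob {\<omega>\<in>space M. config \<omega> \<inter> T = {}}"
  have "Pair x -` T = (if x \<in> cball 0 \<delta> then {2 * \<delta>..} else {})" for x by (auto simp: T_def)
  then have "mark_prob T = (\<lambda>x. measure \<mu> {2 * \<delta>..} * indicator (cball 0 \<delta>) x)"
    by (simp add: mark_prob_def fun_eq_iff indicator_def)
  then have "intensity T = lam * (measure \<mu> {2 * \<delta>..} * measure lborel (cball (0::'a) \<delta>))"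
    by (simp add: intensity_def)
  moreover have "0 < measure lborel (cball (0::'a) \<delta>)" using content_cball_pos[OF \<delta>] by simp
  ultimately have "0 < intensity T" using big intensity_pos by simp
  moreover have p_eq: "p = exp (- intensity T)"
    using prob_config_avoid[OF T] by (simp add: p_def intensity_def)
  ultimately have p: "0 < p" "p < 1" by auto
  have main: "(1 - p) * reach_prob 0 \<delta> L \<le> reach_prob 0 0 L" for L
  proof -
    define E where "E = {\<omega>\<in>space M. config \<omega> \<inter> T = {}}"
    define A where "A = {\<omega>\<in>space M. config \<omega> \<in> reach_event 0 \<delta> L}"
    define A0 where "A0 = {\<omega>\<in>space M. config \<omega> \<in> reach_event 0 0 L}"
    define Q where "Q = {\<omega>\<in>space M. config \<omega> - T \<in> reach_event 0 \<delta> L}"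
    have E[measurable]: "E \<in> events"
      using events_config[OF sets_avoid[OF Ts]] by (simp add: E_def avoid_def)
    have A[measurable]: "A \<in> events" "A0 \<in> events" by (auto simp: A_def A0_def events_config)
    have Q[measurable]: "Q \<in> events"
      using measurable_sets[OF measurable_compose[OF measurable_config measurable_Diff_configurations[OF Ts]] sets_reach_event]
      by (simp add: Q_def vimage_def Int_def conj_commute)
    \<comment> \<open>a ball in \<open>T\<close> joins to the origin the chains of the configuration, also those outside \<open>T\<close>\<close>
    have hit: "AE \<omega> in M. \<omega> \<in> (A \<union> Q) - E \<longrightarrow> \<omega> \<in> A0"
      using AE_locally_finite_config
    proof eventually_elim
      case (elim \<omega>)
      show ?case
      proof
        assume w: "\<omega> \<in> (A \<union> Q) - E"
        then have "reach (config \<omega>) 0 \<delta> L \<or> reach (config \<omega> - T) 0 \<delta> L"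
          using elim locally_finite_set_subset[OF elim, of "config \<omega> - T"]
          by (auto simp: A_def Q_def reach_event_iff)
        then have r: "reach (config \<omega>) 0 \<delta> L" using reach_mono by blast
        obtain q s where qs: "(q, s) \<in> config \<omega>" "(q, s) \<in> T" using w by (auto simp: E_def A_def Q_def)
        then have "reach (config \<omega>) 0 0 L"
          using reach_from_centre[OF r _ qs(1)] \<delta> by (simp add: T_def)
        then show "\<omega> \<in> A0" using w elim by (auto simp: A0_def A_def Q_def reach_event_iff)
      qed
    qed
    have "prob (A - E) \<le> prob A0" "prob (Q - E) \<le> prob A0"
      using hit by (auto intro!: finite_measure_mono_AE)
    moreover have "prob A = prob (A \<inter> E) + prob (A - E)" "prob Q = prob (Q \<inter> E) + prob (Q - E)"
      by (simp_all add: finite_measure_Diff' Int_commute)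
    moreover have "prob (A \<inter> E) = p * prob Q" "prob (Q \<inter> E) = p * prob Q"
    proof -
      have "A \<inter> E = {\<omega>\<in>space M. config \<omega> \<inter> T = {} \<and> config \<omega> - T \<in> reach_event 0 \<delta> L}"
        by (auto simp: A_def E_def Diff_triv)
      moreover have "Q \<inter> E = {\<omega>\<in>space M. config \<omega> \<inter> T = {} \<and> config \<omega> - T \<in> reach_event 0 \<delta> L}"
        by (auto simp: Q_def E_def)
      ultimately show "prob (A \<inter> E) = p * prob Q" "prob (Q \<inter> E) = p * prob Q"
        using prob_avoid_and_rest[OF T sets_reach_event] by (simp_all add: p_def Q_def)
    qed
    ultimately have Q_le: "prob Q - p * prob Q \<le> prob A0" and "prob A \<le> p * prob Q + prob A0"
      by linarith+
    then have "(1 - p) * prob A \<le> (1 - p) * (p * prob Q + prob A0)"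
      using p by (intro mult_left_mono) auto
    also have "\<dots> = p * (prob Q - p * prob Q) + (1 - p) * prob A0" by (simp add: algebra_simps)
    also have "\<dots> \<le> p * prob A0 + (1 - p) * prob A0"
      using p Q_le by (intro add_mono mult_left_mono) auto
    finally show ?thesis by (simp add: reach_prob_def A_def A0_def algebra_simps)
  qed
  show thesis using p main by (intro that[of "1 - p"]) auto
qed

lemma cover_config: "cover (config \<omega>) = occupied y \<rho> \<omega>"
  by (simp add: cover_def config_def occupied_def)

lemma AE_radii_nonneg:
  assumes "AE r in \<mu>. 0 \<le> r"
  shows "AE \<omega> in M. \<forall>z\<in>config \<omega>. 0 \<le> snd z"
proof -
  have "AE r in distr M borel (\<rho> k). 0 \<le> r" for k
    unfolding radii_law by (rule assms)
  then have "AE \<omega> in M. 0 \<le> \<rho> k \<omega>" for k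
    using radii_measurable by (subst (asm) AE_distr_iff) auto
  then have "AE \<omega> in M. \<forall>k. 0 \<le> \<rho> k \<omega>" by (simp add: AE_all_countable)
  then show ?thesis by eventually_elim (auto simp: config_def)
qed

text \<open>
  A chain from the origin stays in the origin's cluster, so the diameter is at least \<open>\<delta>\<close> times the
  number of \<open>j \<ge> 1\<close> such that distance \<open>j * \<delta>\<close> is reached. The measurable minorant is what makes the
  bound meaningful, as the diameter itself is not known to be measurable.
\<close>

lemma summable_reach_prob:
  assumes nn: "AE r in \<mu>. 0 \<le> r" and \<delta>: "0 < \<delta>"
    and fin: "(\<integral>\<^sup>+\<omega>. ediameter (origin_cluster y \<rho> \<omega>) \<partial>M) \<noteq> \<infinity>"
  shows "summable (\<lambda>j. reach_prob 0 0 (real j * \<delta>))"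
proof -
  define A where "A j = {\<omega>\<in>space M. config \<omega> \<in> reach_event 0 0 (real (Suc j) * \<delta>)}" for j
  have A[measurable]: "A j \<in> events" for j by (simp add: A_def events_config)
  have "AE \<omega> in M. (\<Sum>j. ennreal \<delta> * indicator (A j) \<omega>) \<le> ediameter (origin_cluster y \<rho> \<omega>)"
    using AE_locally_finite_config AE_radii_nonneg[OF nn]
  proof eventually_elim
    case (elim \<omega>)
    have *: "ennreal (real (Suc j) * \<delta>) \<le> ediameter (origin_cluster y \<rho> \<omega>)" if "\<omega> \<in> A j" for j
    proof -
      have "reach (config \<omega>) 0 0 (real (Suc j) * \<delta>)"
        using that elim by (simp add: A_def reach_event_iff)
      then show ?thesis
        using reach_imp_ediameter[of "config \<omega>"] elim(2) \<delta> by (simp add: cover_config origin_cluster_def)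
    qed
    have "(\<Sum>j<n. ennreal \<delta> * indicator (A j) \<omega>) \<le> ediameter (origin_cluster y \<rho> \<omega>)" for n
    proof (induction n)
      case (Suc n)
      show ?case
      proof (cases "\<omega> \<in> A n")
        case True
        have "(\<Sum>j<Suc n. ennreal \<delta> * indicator (A j) \<omega>) \<le> (\<Sum>j<Suc n. ennreal \<delta>)"
          by (intro sum_mono) (auto simp: indicator_def)
        also have "\<dots> = ennreal (real (Suc n) * \<delta>)"
          using \<delta> by (simp only: sum_constant card_lessThan ennreal_of_nat_eq_real_of_nat ennreal_mult'' less_imp_le)
        also have "\<dots> \<le> ediameter (origin_cluster y \<rho> \<omega>)" by (rule *[OF True])
        finally show ?thesis .
      qed (use Suc in simp)
    qed simp
    then show ?case unfolding suminf_eq_SUP by (intro SUP_least)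
  qed
  then have "(\<integral>\<^sup>+\<omega>. (\<Sum>j. ennreal \<delta> * indicator (A j) \<omega>) \<partial>M) \<le> (\<integral>\<^sup>+\<omega>. ediameter (origin_cluster y \<rho> \<omega>) \<partial>M)"
    by (rule nn_integral_mono_AE)
  also have "(\<integral>\<^sup>+\<omega>. (\<Sum>j. ennreal \<delta> * indicator (A j) \<omega>) \<partial>M) = (\<Sum>j. \<integral>\<^sup>+\<omega>. ennreal \<delta> * indicator (A j) \<omega> \<partial>M)"
    by (rule nn_integral_suminf) measurable
  also have "\<dots> = (\<Sum>j. ennreal (\<delta> * prob (A j)))"
    using \<delta> by (intro suminf_cong) (simp add: nn_integral_cmult_indicator emeasure_eq_measure ennreal_mult)
  finally have "(\<Sum>j. ennreal (\<delta> * prob (A j))) \<noteq> top"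
    using fin by (auto simp: top_unique)
  then have "summable (\<lambda>j. \<delta> * prob (A j))"
    using \<delta> by (intro summable_suminf_not_top) auto
  then have "summable (\<lambda>j. prob (A j))" using \<delta> by (simp add: summable_cmult_iff)
  then show ?thesis
    unfolding A_def reach_prob_def[symmetric] by (subst summable_Suc_iff[symmetric])
qed

theorem AE_vacant_percolates:
  assumes dim: "2 \<le> DIM('a)" and nn: "AE r in \<mu>. 0 \<le> r" and nontriv: "measure \<mu> {0} < 1"
    and fin: "(\<integral>\<^sup>+\<omega>. ediameter (origin_cluster y \<rho> \<omega>) \<partial>M) \<noteq> \<infinity>"
  shows "AE \<omega> in M. percolates (vacant y \<rho> \<omega>)"
proof -
  interpret \<mu>: prob_space \<mu> by (rule prob_space_mu)
  have "\<exists>n. 0 < measure \<mu> {1 / real (Suc n)..}"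
  proof (rule ccontr)
    assume "\<not> (\<exists>n. 0 < measure \<mu> {1 / real (Suc n)..})"
    then have "measure \<mu> {1 / real (Suc n)..} = 0" for n
      using measure_nonneg[of \<mu>] by (metis not_less order_antisym)
    then have "AE r in \<mu>. r \<notin> {1 / real (Suc n)..}" for n
      by (intro AE_not_in) (simp add: null_sets_def \<mu>.emeasure_eq_measure sets_mu)
    then have "AE r in \<mu>. \<forall>n. r \<notin> {1 / real (Suc n)..}" by (simp add: AE_all_countable)
    with nn have "AE r in \<mu>. r \<in> {0}"
    proof eventually_elim
      case (elim r)
      then show ?case using reals_Archimedean[of r]
        by (auto simp: inverse_eq_divide not_le) (metis less_asym less_le)
    qed
    then have "measure \<mu> {0} = 1" by (subst \<mu>.prob_eq_1) (auto simp: sets_mu)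
    then show False using nontriv by simp
  qed
  then obtain n where n: "0 < measure \<mu> {1 / real (Suc n)..}" by blast
  define \<delta> where "\<delta> = 1 / real (Suc n) / 2"
  have "2 * \<delta> = 1 / real (Suc n)" by (simp add: \<delta>_def del: of_nat_Suc)
  then have \<delta>: "0 < \<delta>" "0 < measure \<mu> {2 * \<delta>..}" using n by (simp_all only:) (simp add: \<delta>_def)
  obtain h where h: "0 < h" "\<And>L. h * reach_prob 0 \<delta> L \<le> reach_prob 0 0 L"
    using reach_prob_sprinkle[OF \<delta>] by metis
  have "summable (\<lambda>j. h * reach_prob 0 \<delta> (real j * \<delta>))"
    by (rule summable_comparison_test'[OF summable_reach_prob[OF nn \<delta>(1) fin], of 0])
      (use h in \<open>auto simp: reach_prob_def\<close>)
  then have summ: "summable (\<lambda>j. reach_prob 0 \<delta> (real j * \<delta>))" using h by (simp add: summable_cmult_iff)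
  have no_reach: "AE \<omega> in M. \<forall>\<^sub>F j in sequentially. \<not> reach (config \<omega>) (x j) \<delta> (real j * \<delta>)" for x :: "nat \<Rightarrow> 'a"
  proof -
    have "AE \<omega> in M. \<forall>\<^sub>F j in sequentially. \<omega> \<in> space M - {\<omega>\<in>space M. config \<omega> \<in> reach_event (x j) \<delta> (real j * \<delta>)}"
    proof (rule borel_cantelli_AE1)
      show "summable (\<lambda>j. prob {\<omega>\<in>space M. config \<omega> \<in> reach_event (x j) \<delta> (real j * \<delta>)})"
        using summ unfolding reach_prob_def[symmetric] by (subst reach_prob_translate)
    qed (auto simp: events_config emeasure_eq_measure)
    with AE_locally_finite_config show ?thesis
    proof eventually_elim
      case (elim \<omega>)
      from elim(2) show ?case by eventually_elim (use elim(1) in \<open>auto simp: reach_event_iff\<close>)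
    qed
  qed
  obtain D :: "'a set" where D: "countable D" "\<And>U. open U \<Longrightarrow> U \<noteq> {} \<Longrightarrow> \<exists>d\<in>D. d \<in> U"
    using countable_dense_exists by metis
  obtain e :: 'a where e: "norm e = 1" using norm_Basis nonempty_Basis by blast
  have "AE \<omega> in M. \<forall>q\<in>D. \<forall>\<^sub>F j in sequentially. \<not> reach (config \<omega>) q \<delta> (real j * \<delta>)"
    using no_reach by (subst AE_ball_countable[OF D(1)]) auto
  with AE_locally_finite_config AE_radii_nonneg[OF nn] no_reach[of "\<lambda>j. (real j * \<delta>) *\<^sub>R e"]
  show ?thesis
  proof eventually_elim
    case (elim \<omega>)
    interpret ball_configuration "config \<omega>" \<delta> D
    proof
      show "\<exists>q\<in>D. dist q x < \<delta>" for x
        using D(2)[of "ball x \<delta>"] \<delta> by (auto simp: dist_commute)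
      show "\<exists>L. \<not> reach (config \<omega>) q \<delta> L" if "q \<in> D" for q
        using elim(4) that eventually_happens'[OF sequentially_bot] by blast
    qed (use elim \<delta> in auto)
    obtain j0 where "\<And>j. j0 \<le> j \<Longrightarrow> \<not> reach (config \<omega>) ((real j * \<delta>) *\<^sub>R e) \<delta> (real j * \<delta>)"
      using elim(3) by (auto simp: eventually_sequentially)
    from vacant_percolates[OF dim e this] show ?case by (simp add: vacant_def cover_config)
  qed
qed

end

theorem mainTheorem3:
  fixes \<mu> :: "real measure"
    and M :: "real \<Rightarrow> 'w measure"
    and y :: "real \<Rightarrow> nat \<Rightarrow> 'w \<Rightarrow> real ^ 'n"
    and \<rho> :: "real \<Rightarrow> nat \<Rightarrow> 'w \<Rightarrow> real"
  assumes dim: "CARD('n) \<ge> 2"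
    and mu_prob: "prob_space \<mu>"
    and mu_sets: "sets \<mu> = sets borel"
    and mu_nonneg: "AE r in \<mu>. 0 \<le> r"
    and mu_nontrivial: "measure \<mu> {0} < 1"
    and model: "\<And>lam. 0 < lam \<Longrightarrow> poisson_boolean_model (M lam) (y lam) lam (\<rho> lam) \<mu>"
  shows "lambda_c_star M y \<rho> \<ge> lambda_D M y \<rho>"
  unfolding lambda_c_star_def
proof (rule INF_greatest, clarify)
  fix lam :: real
  assume lam: "0 < lam"
    and null: "{\<omega> \<in> space (M lam). percolates (vacant (y lam) (\<rho> lam) \<omega>)} \<in> null_sets (completion (M lam))"
  interpret poisson_boolean_model "M lam" "y lam" lam "\<rho> lam" \<mu> by (rule model[OF lam])
  have "(\<integral>\<^sup>+\<omega>. ediameter (origin_cluster (y lam) (\<rho> lam) \<omega>) \<partial>M lam) = \<infinity>"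
  proof (rule ccontr)
    assume "(\<integral>\<^sup>+\<omega>. ediameter (origin_cluster (y lam) (\<rho> lam) \<omega>) \<partial>M lam) \<noteq> \<infinity>"
    then have "AE \<omega> in M lam. percolates (vacant (y lam) (\<rho> lam) \<omega>)"
      using dim mu_nonneg mu_nontrivial by (intro AE_vacant_percolates) auto
    moreover have "AE \<omega> in M lam. \<omega> \<notin> {\<omega> \<in> space (M lam). percolates (vacant (y lam) (\<rho> lam) \<omega>)}"
      using AE_not_in[OF null] by (simp only: AE_completion_iff)
    ultimately have "AE \<omega> in M lam. False" using AE_space by eventually_elim auto
    then show False by simp
  qed
  then show "lambda_D M y \<rho> \<le> ennreal lam"
    unfolding lambda_D_def using lam by (intro INF_lower) auto
qed

end
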